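(* Let $0<\gamma\le1$ and $-\infty<a<\zeta<\infty$. Let $S_\zeta$ be the operator on $L^2(a,\zeta)$ $$(S_\zeta f)(x)=f(x)-\gamma\int_a^\zeta\frac{\sin(x-t)}{\pi(x-t)}f(t)\,dt .$$ Then $S_\zeta$ is positive, invertible, and factorable, and the operator $K_\zeta=I-S_\zeta$ belongs to the trace class.
   Context: For $a\le\mu\le\zeta$ let $(\mathcal P_\mu f)(x)=f(x)$ for $\mu\le x\le\zeta$ and $(\mathcal P_\mu f)(x)=0$ for $a\le x<\mu$, $f\in L^2(a,\zeta)$. An operator $S$ on $L^2(a,\zeta)$ is factorable (admits triangular factorization) if $S=S_-^*S_-$ where $S_-$ and $S_-^{-1}$ are bounded on $L^2(a,\zeta)$ and $S_-^{\pm1}\mathcal P_\mu=\mathcal P_\mu S_-^{\pm1}\mathcal P_\mu$ for all $\mu$. *)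

theory Defs
  imports "HOL-Analysis.Analysis"
begin

text \<open>
  Elements of the complex Hilbert space \<open>L\<^sup>2(M)\<close> are represented by measurable functions, and
  equality in \<open>L\<^sup>2(M)\<close> is equality almost everywhere. Operators are maps on representatives;
  every identity between operators below is therefore stated almost everywhere.
\<close>

definition L2 :: "'a measure \<Rightarrow> ('a \<Rightarrow> complex) set" where
  "L2 M = {f \<in> borel_measurable M. integrable M (\<lambda>x. (cmod (f x))\<^sup>2)}"

definition l2_inner :: "'a measure \<Rightarrow> ('a \<Rightarrow> complex) \<Rightarrow> ('a \<Rightarrow> complex) \<Rightarrow> complex" where
  "l2_inner M f g = (LINT x|M. f x * cnj (g x))"

definition l2_norm :: "'a measure \<Rightarrow> ('a \<Rightarrow> complex) \<Rightarrow> real" where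
  "l2_norm M f = sqrt (LINT x|M. (cmod (f x))\<^sup>2)"

type_synonym 'a l2_op = "('a \<Rightarrow> complex) \<Rightarrow> ('a \<Rightarrow> complex)"

definition op_eq :: "'a measure \<Rightarrow> 'a l2_op \<Rightarrow> 'a l2_op \<Rightarrow> bool" where
  "op_eq M A B \<longleftrightarrow> (\<forall>f\<in>L2 M. AE x in M. A f x = B f x)"

text \<open>
  Linearity together with the norm bound forces \<open>A\<close> to send functions that agree almost
  everywhere to functions that agree almost everywhere, so \<open>A\<close> descends to classes.
\<close>

definition bounded_op :: "'a measure \<Rightarrow> 'a l2_op \<Rightarrow> bool" where
  "bounded_op M A \<longleftrightarrow>
     (\<forall>f\<in>L2 M. A f \<in> L2 M) \<and>
     (\<forall>f\<in>L2 M. \<forall>g\<in>L2 M. AE x in M. A (\<lambda>y. f y + g y) x = A f x + A g x) \<and>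
     (\<forall>f\<in>L2 M. \<forall>c. AE x in M. A (\<lambda>y. c * f y) x = c * A f x) \<and>
     (\<exists>C. \<forall>f\<in>L2 M. l2_norm M (A f) \<le> C * l2_norm M f)"

definition inverse_ops :: "'a measure \<Rightarrow> 'a l2_op \<Rightarrow> 'a l2_op \<Rightarrow> bool" where
  "inverse_ops M A B \<longleftrightarrow>
     bounded_op M A \<and> bounded_op M B \<and> op_eq M (A \<circ> B) id \<and> op_eq M (B \<circ> A) id"

definition invertible_op :: "'a measure \<Rightarrow> 'a l2_op \<Rightarrow> bool" where
  "invertible_op M A \<longleftrightarrow> (\<exists>B. inverse_ops M A B)"

definition adjoint_ops :: "'a measure \<Rightarrow> 'a l2_op \<Rightarrow> 'a l2_op \<Rightarrow> bool" where
  "adjoint_ops M A B \<longleftrightarrow>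
     bounded_op M A \<and> bounded_op M B \<and>
     (\<forall>f\<in>L2 M. \<forall>g\<in>L2 M. l2_inner M (A f) g = l2_inner M f (B g))"

definition positive_op :: "'a measure \<Rightarrow> 'a l2_op \<Rightarrow> bool" where
  "positive_op M A \<longleftrightarrow>
     bounded_op M A \<and>
     (\<forall>f\<in>L2 M. l2_inner M (A f) f \<in> \<real> \<and> 0 \<le> Re (l2_inner M (A f) f))"

definition orthonormal_basis :: "'a measure \<Rightarrow> ('a \<Rightarrow> complex) set \<Rightarrow> bool" where
  "orthonormal_basis M E \<longleftrightarrow>
     E \<subseteq> L2 M \<and>
     (\<forall>e\<in>E. \<forall>e'\<in>E. l2_inner M e e' = (if e = e' then 1 else 0)) \<and>
     (\<forall>f\<in>L2 M. (\<forall>e\<in>E. l2_inner M f e = 0) \<longrightarrow> (AE x in M. f x = 0))"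

definition absolute_value_op :: "'a measure \<Rightarrow> 'a l2_op \<Rightarrow> 'a l2_op \<Rightarrow> bool" where
  "absolute_value_op M A P \<longleftrightarrow>
     positive_op M P \<and> (\<exists>B. adjoint_ops M A B \<and> op_eq M (P \<circ> P) (B \<circ> A))"

text \<open>
  \<open>A\<close> is of trace class when the trace of \<open>|A| = (A\<^sup>* A)\<^sup>1\<^sup>/\<^sup>2\<close> is finite. Neither the choice of \<open>P\<close>
  (unique up to almost-everywhere equality) nor that of the basis matters.
\<close>

definition trace_class :: "'a measure \<Rightarrow> 'a l2_op \<Rightarrow> bool" where
  "trace_class M A \<longleftrightarrow>
     bounded_op M A \<and>
     (\<exists>P E. absolute_value_op M A P \<and> orthonormal_basis M E \<and>
            (\<lambda>e. l2_inner M (P e) e) summable_on E)"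

text \<open>
  The measure underlying \<open>L\<^sup>2(a, \<zeta>)\<close>. Borel representatives suffice, since every Lebesgue
  measurable function agrees almost everywhere with a Borel measurable one.
\<close>

definition interval_measure_on :: "real \<Rightarrow> real \<Rightarrow> real measure" where
  "interval_measure_on a \<zeta> = restrict_space lborel {a<..<\<zeta>}"

definition cutoff :: "real \<Rightarrow> real \<Rightarrow> real l2_op" where
  "cutoff \<zeta> \<mu> f = (\<lambda>x. if \<mu> \<le> x \<and> x \<le> \<zeta> then f x else 0)"

definition factorable :: "real \<Rightarrow> real \<Rightarrow> real l2_op \<Rightarrow> bool" where
  "factorable a \<zeta> S \<longleftrightarrow>
     (let M = interval_measure_on a \<zeta> in
      \<exists>A A_inv A_adj.
        inverse_ops M A A_inv \<and> adjoint_ops M A A_adj \<and> op_eq M S (A_adj \<circ> A) \<and>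
        (\<forall>\<mu>\<in>{a..\<zeta>}.
           op_eq M (A \<circ> cutoff \<zeta> \<mu>) (cutoff \<zeta> \<mu> \<circ> A \<circ> cutoff \<zeta> \<mu>) \<and>
           op_eq M (A_inv \<circ> cutoff \<zeta> \<mu>) (cutoff \<zeta> \<mu> \<circ> A_inv \<circ> cutoff \<zeta> \<mu>)))"

text \<open>On the diagonal the kernel takes its limiting value instead of the convention \<open>x / 0 = 0\<close>.\<close>

definition sine_kernel :: "real \<Rightarrow> real \<Rightarrow> real" where
  "sine_kernel x t = (if x = t then 1 / pi else sin (x - t) / (pi * (x - t)))"

definition S_op :: "real \<Rightarrow> real \<Rightarrow> real \<Rightarrow> real l2_op" where
  "S_op \<gamma> a \<zeta> f =
     (\<lambda>x. f x - of_real \<gamma> *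
        (LINT t|interval_measure_on a \<zeta>. of_real (sine_kernel x t) * f t))"

end

theory Submission
  imports Defs "HOL-Complex_Analysis.Great_Picard"
begin

text \<open>
  The sine kernel is the Fourier transform of the indicator of \<open>[-1, 1]\<close>, so \<open>\<langle>K f, f\<rangle>\<close> is the
  energy of the Fourier transform of \<open>f\<close> on \<open>[-1, 1]\<close> divided by \<open>2 \<pi>\<close>. By Bessel's inequality this
  is at most \<open>\<parallel>f\<parallel>\<^sup>2\<close>, and since the transform of a compactly supported function is entire, a normal
  families argument improves the bound to \<open>q \<parallel>f\<parallel>\<^sup>2\<close> with \<open>q < 1\<close>.

  For every \<open>t\<close> the Neumann series for the compression of \<open>S = I - k\<close>, where \<open>k = \<gamma> K\<close>, to \<open>[t, \<zeta>]\<close>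
  therefore converges uniformly to a solution \<open>V (\<cdot>, t)\<close> of \<open>V - k V = k\<close> on \<open>[t, \<zeta>]\<close>. The lower
  triangular kernel \<open>V\<close> makes \<open>S (I + V) = I + U\<close> upper triangular. Then \<open>(I + V)\<^sup>* S (I + V)\<close> is
  both self-adjoint and upper triangular, hence the identity, and \<open>S = A\<^sup>* A\<close> with
  \<open>A = (I + V)\<^sup>-\<^sup>1\<close>. The trace of \<open>k \<ge> 0\<close> in any orthonormal basis is bounded by applying Bessel's
  inequality to the exponentials \<open>exp (i \<xi> t)\<close>, \<open>\<xi> \<in> [-1, 1]\<close>.
\<close>

section \<open>Hilbert space geometry of square-integrable functions\<close>

lemma L2_measurable: "f \<in> L2 M \<Longrightarrow> f \<in> borel_measurable M"
  and L2_integrable_sq: "f \<in> L2 M \<Longrightarrow> integrable M (\<lambda>x. (cmod (f x))\<^sup>2)"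
  by (auto simp: L2_def)

lemma L2_mult_integrable:
  assumes "f \<in> L2 M" "g \<in> L2 M"
  shows "integrable M (\<lambda>x. f x * g x)"
proof (rule Bochner_Integration.integrable_bound)
  show "integrable M (\<lambda>x. (cmod (f x))\<^sup>2 + (cmod (g x))\<^sup>2)"
    using assms by (auto simp: L2_def)
  show "(\<lambda>x. f x * g x) \<in> borel_measurable M"
    using assms[THEN L2_measurable] by measurable
  have "u * v \<le> u\<^sup>2 + v\<^sup>2" if "0 \<le> u" "0 \<le> v" for u v :: real
  proof -
    have "0 \<le> u * v" using that by simp
    then show ?thesis using sum_squares_bound[of u v] by simp
  qed
  then show "AE x in M. norm (f x * g x) \<le> norm ((cmod (f x))\<^sup>2 + (cmod (g x))\<^sup>2)"
    by (auto simp: norm_mult)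
qed

lemma borel_measurable_cnj [measurable (raw)]:
  "f \<in> borel_measurable M \<Longrightarrow> (\<lambda>x. cnj (f x)) \<in> borel_measurable M"
  by (rule measurable_compose[of f M borel cnj])
    (auto intro: borel_measurable_continuous_onI continuous_intros)

lemma L2_cnj: "f \<in> L2 M \<Longrightarrow> (\<lambda>x. cnj (f x)) \<in> L2 M"
  by (auto simp: L2_def)

lemma L2_cmod: "f \<in> L2 M \<Longrightarrow> (\<lambda>x. complex_of_real (cmod (f x))) \<in> L2 M"
  by (auto simp: L2_def)

lemma L2_inner_integrable:
  "f \<in> L2 M \<Longrightarrow> g \<in> L2 M \<Longrightarrow> integrable M (\<lambda>x. f x * cnj (g x))"
  by (intro L2_mult_integrable L2_cnj)

lemma L2_cmult: "f \<in> L2 M \<Longrightarrow> (\<lambda>x. c * f x) \<in> L2 M"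
  by (auto simp: L2_def norm_mult power_mult_distrib)

text \<open>A pointwise substitute for the triangle inequality of \<open>l2_norm\<close>. The
  constant 2 is good enough both for closure of \<open>L2\<close> under sums and for boundedness of
  \<open>id_plus\<close>.\<close>

lemma cmod_add_sq_le: "(cmod (u + v))\<^sup>2 \<le> 2 * (cmod u)\<^sup>2 + 2 * (cmod v)\<^sup>2"
proof -
  have "(cmod (u + v))\<^sup>2 \<le> (cmod u + cmod v)\<^sup>2"
    by (intro power_mono norm_triangle_ineq) auto
  also have "\<dots> \<le> 2 * (cmod u)\<^sup>2 + 2 * (cmod v)\<^sup>2"
    using sum_squares_bound[of "cmod u" "cmod v"] by (simp add: power2_sum)
  finally show ?thesis .
qed

lemma L2_add:
  assumes "f \<in> L2 M" "g \<in> L2 M"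
  shows "(\<lambda>x. f x + g x) \<in> L2 M"
proof -
  have m: "(\<lambda>x. f x + g x) \<in> borel_measurable M"
    using assms[THEN L2_measurable] by measurable
  have "integrable M (\<lambda>x. (cmod (f x + g x))\<^sup>2)"
  proof (rule Bochner_Integration.integrable_bound)
    show "integrable M (\<lambda>x. 2 * (cmod (f x))\<^sup>2 + 2 * (cmod (g x))\<^sup>2)"
      using assms by (auto simp: L2_def)
    show "(\<lambda>x. (cmod (f x + g x))\<^sup>2) \<in> borel_measurable M"
      using m by measurable
  qed (use cmod_add_sq_le in auto)
  then show ?thesis using m by (auto simp: L2_def)
qed

lemma L2_diff: "f \<in> L2 M \<Longrightarrow> g \<in> L2 M \<Longrightarrow> (\<lambda>x. f x - g x) \<in> L2 M"
  using L2_add[of f M "\<lambda>x. -1 * g x"] L2_cmult[of g M "-1"] by simp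

lemma L2_zero: "(\<lambda>x. 0) \<in> L2 M"
  by (auto simp: L2_def)

lemma L2_sum: "(\<And>i. i \<in> I \<Longrightarrow> f i \<in> L2 M) \<Longrightarrow> (\<lambda>x. \<Sum>i\<in>I. f i x) \<in> L2 M"
proof (induction I rule: infinite_finite_induct)
  case (insert j I)
  have "(\<lambda>x. f j x + (\<Sum>i\<in>I. f i x)) \<in> L2 M"
    by (intro L2_add insert.IH insert.prems) auto
  then show ?case using insert.hyps by simp
qed (simp_all add: L2_zero)

lemma l2_norm_nonneg [simp]: "0 \<le> l2_norm M f"
  by (simp add: l2_norm_def)

lemma l2_norm_sq: "(l2_norm M f)\<^sup>2 = (LINT x|M. (cmod (f x))\<^sup>2)"
  by (simp add: l2_norm_def)

lemma l2_inner_self: "l2_inner M f f = of_real ((l2_norm M f)\<^sup>2)"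
  unfolding l2_norm_sq l2_inner_def integral_complex_of_real [symmetric]
  by (simp flip: complex_norm_square)

lemma l2_inner_cnj: "l2_inner M g f = cnj (l2_inner M f g)"
proof -
  have "cnj (l2_inner M f g) = (LINT x|M. cnj (f x * cnj (g x)))"
    unfolding l2_inner_def by (rule Bochner_Integration.integral_cnj [symmetric])
  then show ?thesis by (simp add: l2_inner_def mult.commute)
qed

lemma l2_inner_add_left:
  "f \<in> L2 M \<Longrightarrow> g \<in> L2 M \<Longrightarrow> h \<in> L2 M \<Longrightarrow>
    l2_inner M (\<lambda>x. f x + g x) h = l2_inner M f h + l2_inner M g h"
  by (simp add: l2_inner_def distrib_right L2_inner_integrable)

lemma l2_inner_add_right:
  "f \<in> L2 M \<Longrightarrow> g \<in> L2 M \<Longrightarrow> h \<in> L2 M \<Longrightarrow>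
    l2_inner M h (\<lambda>x. f x + g x) = l2_inner M h f + l2_inner M h g"
  by (simp add: l2_inner_def distrib_left L2_inner_integrable)

lemma l2_inner_diff_left:
  "f \<in> L2 M \<Longrightarrow> g \<in> L2 M \<Longrightarrow> h \<in> L2 M \<Longrightarrow>
    l2_inner M (\<lambda>x. f x - g x) h = l2_inner M f h - l2_inner M g h"
  by (simp add: l2_inner_def left_diff_distrib L2_inner_integrable)

lemma l2_inner_cmult_left: "l2_inner M (\<lambda>x. c * f x) h = c * l2_inner M f h"
  by (simp add: l2_inner_def mult.assoc)

lemma l2_inner_cmult_right: "l2_inner M f (\<lambda>x. c * h x) = cnj c * l2_inner M f h"
  by (simp add: l2_inner_def mult.left_commute)

lemma l2_inner_sum_left:
  assumes "\<And>i. i \<in> I \<Longrightarrow> f i \<in> L2 M" "h \<in> L2 M"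
  shows "l2_inner M (\<lambda>x. \<Sum>i\<in>I. f i x) h = (\<Sum>i\<in>I. l2_inner M (f i) h)"
  using assms by (simp add: l2_inner_def sum_distrib_right L2_inner_integrable)

lemma l2_norm_cmult: "l2_norm M (\<lambda>x. c * f x) = cmod c * l2_norm M f"
  by (simp add: l2_norm_def norm_mult power_mult_distrib real_sqrt_mult)

lemma l2_norm_zero_imp_AE:
  assumes "f \<in> L2 M" "l2_norm M f = 0"
  shows "AE x in M. f x = 0"
proof -
  have "(LINT x|M. (cmod (f x))\<^sup>2) = 0"
    using assms(2) by (simp flip: l2_norm_sq)
  then have "AE x in M. (cmod (f x))\<^sup>2 = 0"
    using integral_nonneg_eq_0_iff_AE[OF L2_integrable_sq[OF assms(1)]] by simp
  then show ?thesis by simp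
qed

lemma l2_norm_bound:
  assumes "f \<in> borel_measurable M" "g \<in> L2 M" "\<And>x. x \<in> space M \<Longrightarrow> cmod (f x) \<le> cmod (g x)"
  shows "f \<in> L2 M" "l2_norm M f \<le> l2_norm M g"
proof -
  have le: "(cmod (f x))\<^sup>2 \<le> (cmod (g x))\<^sup>2" if "x \<in> space M" for x
    using assms(3)[OF that] by (simp add: power_mono)
  have i: "integrable M (\<lambda>x. (cmod (f x))\<^sup>2)"
    by (rule Bochner_Integration.integrable_bound[OF L2_integrable_sq[OF assms(2)]])
      (use assms(1) le in auto)
  then show "f \<in> L2 M" using assms(1) by (simp add: L2_def)
  show "l2_norm M f \<le> l2_norm M g"
    unfolding l2_norm_def
    by (intro real_sqrt_le_mono integral_mono i L2_integrable_sq[OF assms(2)] le)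
qed

text \<open>Integrates a pointwise weighted AM-GM inequality. Its weights make the two squares
  contribute \<open>u * v / 2\<close> each; they divide by the norms, so a vanishing norm is treated
  separately.\<close>

lemma L2_Cauchy_Schwarz:
  assumes f: "f \<in> L2 M" and g: "g \<in> L2 M"
  shows "cmod (l2_inner M f g) \<le> l2_norm M f * l2_norm M g"
proof (cases "l2_norm M f = 0 \<or> l2_norm M g = 0")
  case True
  then have "AE x in M. f x * cnj (g x) = 0"
    using l2_norm_zero_imp_AE[OF f] l2_norm_zero_imp_AE[OF g] by auto
  then show ?thesis
    by (simp add: l2_inner_def integral_eq_zero_AE)
next
  case False
  define u v where "u = l2_norm M f" and "v = l2_norm M g"
  have pos: "u > 0" "v > 0"
    using False by (auto simp: u_def v_def order_less_le)
  have amgm: "p * q \<le> v / (2 * u) * p\<^sup>2 + u / (2 * v) * q\<^sup>2" for p q :: real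
  proof -
    have "0 \<le> (v * p - u * q)\<^sup>2 / (2 * u * v)" using pos by simp
    also have "\<dots> = v / (2 * u) * p\<^sup>2 + u / (2 * v) * q\<^sup>2 - p * q"
      using pos by (simp add: field_simps power2_eq_square)
    finally show ?thesis by simp
  qed
  have "cmod (l2_inner M f g) \<le> (LINT x|M. cmod (f x * cnj (g x)))"
    unfolding l2_inner_def by (rule integral_norm_bound)
  also have "\<dots> \<le> (LINT x|M. v / (2 * u) * (cmod (f x))\<^sup>2 + u / (2 * v) * (cmod (g x))\<^sup>2)"
    by (intro integral_mono integrable_norm L2_inner_integrable f g
        Bochner_Integration.integrable_add integrable_mult_right L2_integrable_sq)
      (use amgm in \<open>simp add: norm_mult\<close>)
  also have "\<dots> = v / (2 * u) * u\<^sup>2 + u / (2 * v) * v\<^sup>2"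
    using f g by (simp add: L2_integrable_sq u_def v_def flip: l2_norm_sq)
  also have "\<dots> = u * v"
    using pos by (simp add: field_simps power2_eq_square)
  finally show ?thesis by (simp add: u_def v_def)
qed

text \<open>With \<open>p\<close> the orthogonal projection of \<open>f\<close> onto the span, the
  squared norm of \<open>f - p\<close> is nonnegative and expands to the difference of the two
  sides.\<close>

lemma L2_Bessel:
  assumes "finite I" and f: "f \<in> L2 M" and e: "\<And>i. i \<in> I \<Longrightarrow> e i \<in> L2 M"
    and orth: "\<And>i j. i \<in> I \<Longrightarrow> j \<in> I \<Longrightarrow> l2_inner M (e i) (e j) = (if i = j then 1 else 0)"
  shows "(\<Sum>i\<in>I. (cmod (l2_inner M f (e i)))\<^sup>2) \<le> (l2_norm M f)\<^sup>2"
proof -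
  define c where "c i = l2_inner M f (e i)" for i
  define p where "p = (\<lambda>x. \<Sum>i\<in>I. c i * e i x)"
  have p: "p \<in> L2 M"
    unfolding p_def by (intro L2_sum L2_cmult e)
  have inner_p: "l2_inner M p h = (\<Sum>i\<in>I. c i * l2_inner M (e i) h)" if "h \<in> L2 M" for h
    unfolding p_def using that e
    by (subst l2_inner_sum_left) (auto simp: l2_inner_cmult_left intro!: L2_cmult)
  have pe: "l2_inner M p (e j) = c j" if "j \<in> I" for j
  proof -
    have "l2_inner M p (e j) = (\<Sum>i\<in>I. if i = j then c i else 0)"
      unfolding inner_p[OF e[OF that]] using that by (intro sum.cong) (auto simp: orth)
    then show ?thesis using that \<open>finite I\<close> by simp
  qed
  have "l2_inner M (e i) f = cnj (c i)" for i
    by (simp add: c_def l2_inner_cnj[of M "e i" f])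
  then have pf: "l2_inner M p f = of_real (\<Sum>i\<in>I. (cmod (c i))\<^sup>2)"
    by (simp add: inner_p f flip: complex_norm_square)
  have fp: "l2_inner M f p = of_real (\<Sum>i\<in>I. (cmod (c i))\<^sup>2)"
    using l2_inner_cnj[of M f p] pf by simp
  have "l2_inner M (e i) p = cnj (c i)" if "i \<in> I" for i
    using pe[OF that] by (simp add: l2_inner_cnj[of M "e i" p])
  then have pp: "l2_inner M p p = of_real (\<Sum>i\<in>I. (cmod (c i))\<^sup>2)"
    by (simp add: inner_p p flip: complex_norm_square)
  have "l2_inner M (\<lambda>x. f x - p x) (\<lambda>x. f x - p x)
      = l2_inner M f (\<lambda>x. f x + -1 * p x) - l2_inner M p (\<lambda>x. f x + -1 * p x)"
    using f p L2_diff[OF f p] by (simp add: l2_inner_diff_left)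
  also have "\<dots> = (l2_inner M f f - l2_inner M f p) - (l2_inner M p f - l2_inner M p p)"
    unfolding l2_inner_add_right[OF f L2_cmult[OF p] f] l2_inner_add_right[OF f L2_cmult[OF p] p]
      l2_inner_cmult_right by simp
  also have "\<dots> = of_real ((l2_norm M f)\<^sup>2 - (\<Sum>i\<in>I. (cmod (c i))\<^sup>2))"
    by (simp add: pf fp pp l2_inner_self[of M f])
  finally have "of_real ((l2_norm M (\<lambda>x. f x - p x))\<^sup>2)
      = complex_of_real ((l2_norm M f)\<^sup>2 - (\<Sum>i\<in>I. (cmod (c i))\<^sup>2))"
    unfolding l2_inner_self .
  then have "(l2_norm M (\<lambda>x. f x - p x))\<^sup>2 = (l2_norm M f)\<^sup>2 - (\<Sum>i\<in>I. (cmod (c i))\<^sup>2)"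
    using of_real_eq_iff by blast
  then show ?thesis unfolding c_def by (smt (verit) zero_le_power2)
qed

text \<open>\<open>trace_class\<close> asks for some basis. Zorn's lemma gives a maximal orthonormal
  set, and it is complete: a vector orthogonal to it with nonzero norm could be normalised and
  added.\<close>

lemma orthonormal_basis_exists: "\<exists>E. orthonormal_basis M E"
proof -
  define \<A> where "\<A> = {E. E \<subseteq> L2 M \<and>
    (\<forall>e\<in>E. \<forall>e'\<in>E. l2_inner M e e' = (if e = e' then 1 else 0))}"
  have "\<exists>E\<in>\<A>. \<forall>X\<in>\<A>. E \<subseteq> X \<longrightarrow> X = E"
  proof (rule subset_Zorn')
    fix \<C> assume ch: "subset.chain \<A> \<C>"
    then have sub: "\<C> \<subseteq> \<A>"
      and lin: "\<And>X Y. X \<in> \<C> \<Longrightarrow> Y \<in> \<C> \<Longrightarrow> X \<subseteq> Y \<or> Y \<subseteq> X"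
      by (auto simp: subset_chain_def)
    \<comment> \<open>In a chain, the larger of \<open>X\<close> and \<open>Y\<close> contains both
      vectors.\<close>
    have "l2_inner M e e' = (if e = e' then 1 else 0)"
      if "e \<in> X" "X \<in> \<C>" "e' \<in> Y" "Y \<in> \<C>" for e e' X Y
      using lin[OF that(2,4)] that sub unfolding \<A>_def by blast
    then show "\<Union>\<C> \<in> \<A>"
      using sub unfolding \<A>_def by blast
  qed
  then obtain E where E: "E \<in> \<A>" and max: "\<And>X. X \<in> \<A> \<Longrightarrow> E \<subseteq> X \<Longrightarrow> X = E" by blast
  have "AE x in M. f x = 0" if f: "f \<in> L2 M" and orth: "\<forall>e\<in>E. l2_inner M f e = 0" for f
  proof (rule l2_norm_zero_imp_AE[OF f], rule ccontr)
    assume nz: "l2_norm M f \<noteq> 0"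
    define g where "g = (\<lambda>x. complex_of_real (1 / l2_norm M f) * f x)"
    have g: "g \<in> L2 M" unfolding g_def by (intro L2_cmult f)
    have "l2_norm M g = 1"
      using nz unfolding g_def l2_norm_cmult norm_of_real by simp
    then have gg: "l2_inner M g g = 1" by (simp add: l2_inner_self)
    have ge: "l2_inner M g e = 0" if "e \<in> E" for e
      using orth that unfolding g_def l2_inner_cmult_left by simp
    have eg: "l2_inner M e g = 0" if "e \<in> E" for e
      using ge[OF that] l2_inner_cnj[of M e g] by simp
    have "g \<notin> E" using ge gg by force
    moreover have "insert g E \<in> \<A>"
      using E g gg ge eg \<open>g \<notin> E\<close> unfolding \<A>_def by auto
    ultimately show False using max by blast
  qed
  then have "orthonormal_basis M E"
    using E unfolding orthonormal_basis_def \<A>_def by blast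
  then show ?thesis ..
qed

section \<open>Integral operators with bounded kernels\<close>

text \<open>Measurability and boundedness are required on the whole plane, so that kernels can be
  transposed and composed freely; over a finite measure every integral needed then
  converges.\<close>

definition bounded_kernel :: "(real \<Rightarrow> real \<Rightarrow> real) \<Rightarrow> bool" where
  "bounded_kernel h \<longleftrightarrow>
    (\<lambda>(x, t). h x t) \<in> borel_measurable (borel \<Otimes>\<^sub>M borel) \<and> (\<exists>C. \<forall>x t. \<bar>h x t\<bar> \<le> C)"

definition kernel_op :: "real measure \<Rightarrow> (real \<Rightarrow> real \<Rightarrow> real) \<Rightarrow> real l2_op" where
  "kernel_op M h f = (\<lambda>x. LINT t|M. of_real (h x t) * f t)"

definition kernel_comp ::
    "real measure \<Rightarrow> (real \<Rightarrow> real \<Rightarrow> real) \<Rightarrow> (real \<Rightarrow> real \<Rightarrow> real) \<Rightarrow> real \<Rightarrow> real \<Rightarrow> real" where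
  "kernel_comp M h k = (\<lambda>x t. LINT s|M. h x s * k s t)"

definition id_plus :: "real measure \<Rightarrow> (real \<Rightarrow> real \<Rightarrow> real) \<Rightarrow> real l2_op" where
  "id_plus M h f = (\<lambda>x. f x + kernel_op M h f x)"

lemma bounded_kernelI:
  "(\<lambda>(x, t). h x t) \<in> borel_measurable (borel \<Otimes>\<^sub>M borel) \<Longrightarrow> (\<And>x t. \<bar>h x t\<bar> \<le> C) \<Longrightarrow> bounded_kernel h"
  unfolding bounded_kernel_def by blast

lemma bounded_kernel_bound:
  assumes "bounded_kernel h"
  obtains C where "0 \<le> C" "\<And>x t. \<bar>h x t\<bar> \<le> C"
  using assms unfolding bounded_kernel_def by (meson abs_ge_zero order_trans)

lemma bounded_kernel_measurable:
  "bounded_kernel h \<Longrightarrow> f \<in> borel_measurable N \<Longrightarrow> g \<in> borel_measurable N \<Longrightarrow>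
    (\<lambda>x. h (f x) (g x)) \<in> borel_measurable N"
  unfolding bounded_kernel_def
  by (auto intro: measurable_compose[of "\<lambda>x. (f x, g x)" N "borel \<Otimes>\<^sub>M borel" "\<lambda>(x, t). h x t", simplified])

lemma bounded_kernel_borel:
  "bounded_kernel h \<Longrightarrow> (\<lambda>(x, t). h x t) \<in> borel_measurable (borel \<Otimes>\<^sub>M borel)"
  unfolding bounded_kernel_def by simp

lemma bounded_kernel_transpose:
  assumes "bounded_kernel h" shows "bounded_kernel (\<lambda>x t. h t x)"
proof -
  obtain C where "0 \<le> C" and C: "\<And>x t. \<bar>h x t\<bar> \<le> C" using bounded_kernel_bound[OF assms] by blast
  have "(\<lambda>(x, t). h t x) \<in> borel_measurable (borel \<Otimes>\<^sub>M borel)"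
    unfolding split_beta' by (rule bounded_kernel_measurable[OF assms measurable_snd measurable_fst])
  then show ?thesis by (rule bounded_kernelI[OF _ C])
qed

lemma bounded_kernel_add:
  assumes "bounded_kernel h" "bounded_kernel k" shows "bounded_kernel (\<lambda>x t. h x t + k x t)"
proof -
  obtain C where "0 \<le> C" and C: "\<And>x t. \<bar>h x t\<bar> \<le> C" using bounded_kernel_bound[OF assms(1)] by blast
  obtain D where "0 \<le> D" and D: "\<And>x t. \<bar>k x t\<bar> \<le> D" using bounded_kernel_bound[OF assms(2)] by blast
  have "(\<lambda>(x, t). h x t + k x t) \<in> borel_measurable (borel \<Otimes>\<^sub>M borel)"
    unfolding split_beta'
    by (rule borel_measurable_add; rule bounded_kernel_measurable[OF _ measurable_fst measurable_snd];
        fact assms)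
  moreover have "\<bar>h x t + k x t\<bar> \<le> C + D" for x t
    using C[of x t] D[of x t] by linarith
  ultimately show ?thesis by (rule bounded_kernelI)
qed

text \<open>Supplies the hypothesis of each application of Fubini below: a bounded factor does not
  spoil the integrability of a tensor product of integrable functions.\<close>

lemma (in pair_sigma_finite) integrable_bounded_mult_prod:
  fixes H :: "'a \<Rightarrow> 'b \<Rightarrow> complex" and u :: "'a \<Rightarrow> complex" and v :: "'b \<Rightarrow> complex"
  assumes H: "(\<lambda>(x, y). H x y) \<in> borel_measurable (M1 \<Otimes>\<^sub>M M2)" "\<And>x y. cmod (H x y) \<le> C"
    and u: "integrable M1 u" and v: "integrable M2 v"
  shows "integrable (M1 \<Otimes>\<^sub>M M2) (\<lambda>(x, y). H x y * (u x * v y))"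
proof (rule Bochner_Integration.integrable_bound)
  have [measurable]: "u \<in> borel_measurable M1" "v \<in> borel_measurable M2"
    using u v by auto
  show "integrable (M1 \<Otimes>\<^sub>M M2) (\<lambda>(x, y). C *\<^sub>R (u x * v y))"
    by (rule Fubini_integrable)
      (use u v in \<open>auto simp: norm_mult integrable_norm\<close>)
  show "(\<lambda>(x, y). H x y * (u x * v y)) \<in> borel_measurable (M1 \<Otimes>\<^sub>M M2)"
    using H(1) by measurable
  have "norm (H x y * (u x * v y)) \<le> norm (C *\<^sub>R (u x * v y))" for x y
    using H(2)[of x y] unfolding norm_mult norm_scaleR
    by (intro mult_right_mono) (auto intro: order_trans[OF _ abs_ge_self])
  then show "AE p in M1 \<Otimes>\<^sub>M M2. norm (case p of (x, y) \<Rightarrow> H x y * (u x * v y))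
      \<le> norm (case p of (x, y) \<Rightarrow> C *\<^sub>R (u x * v y))"
    by (auto simp: split_beta')
qed

lemma (in finite_measure) L2_const: "(\<lambda>x. c) \<in> L2 M"
  by (simp add: L2_def)

lemma (in finite_measure) L2_bounded:
  assumes "f \<in> borel_measurable M" "\<And>x. x \<in> space M \<Longrightarrow> cmod (f x) \<le> C"
  shows "f \<in> L2 M" "l2_norm M f \<le> \<bar>C\<bar> * sqrt (measure M (space M))"
proof -
  have b: "cmod (f x) \<le> cmod (of_real \<bar>C\<bar>)" if "x \<in> space M" for x
    using assms(2)[OF that] by simp
  show "f \<in> L2 M" by (rule l2_norm_bound(1)[OF assms(1) L2_const b])
  have "l2_norm M f \<le> l2_norm M (\<lambda>x. of_real \<bar>C\<bar>)" by (rule l2_norm_bound(2)[OF assms(1) L2_const b])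
  also have "\<dots> = \<bar>C\<bar> * sqrt (measure M (space M))"
    by (simp add: l2_norm_def real_sqrt_mult)
  finally show "l2_norm M f \<le> \<bar>C\<bar> * sqrt (measure M (space M))" .
qed

lemma (in finite_measure) L2_integrable: "f \<in> L2 M \<Longrightarrow> integrable M f"
  using L2_mult_integrable[OF _ L2_const[of 1]] by simp

lemma (in finite_measure) L2_integral_norm_le:
  assumes f: "f \<in> L2 M"
  shows "(LINT x|M. cmod (f x)) \<le> sqrt (measure M (space M)) * l2_norm M f"
proof -
  have "l2_inner M (\<lambda>x. of_real (cmod (f x))) (\<lambda>x. 1) = of_real (LINT x|M. cmod (f x))"
    by (simp add: l2_inner_def)
  then have "\<bar>LINT x|M. cmod (f x)\<bar> = cmod (l2_inner M (\<lambda>x. of_real (cmod (f x))) (\<lambda>x. 1))"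
    by simp
  also have "\<dots> \<le> l2_norm M (\<lambda>x. of_real (cmod (f x))) * l2_norm M (\<lambda>x. 1)"
    by (rule L2_Cauchy_Schwarz[OF L2_cmod[OF f] L2_const])
  also have "\<dots> = sqrt (measure M (space M)) * l2_norm M f"
    by (simp add: l2_norm_def)
  finally show ?thesis by simp
qed

lemma (in finite_measure) L2_integral_bounded_mult_le:
  assumes f: "f \<in> L2 M" and h: "\<And>x. x \<in> space M \<Longrightarrow> cmod (h x) \<le> C" and "0 \<le> C"
  shows "cmod (LINT x|M. h x * f x) \<le> C * sqrt (measure M (space M)) * l2_norm M f"
proof -
  have "cmod (LINT x|M. h x * f x) \<le> (LINT x|M. C * cmod (f x))"
  proof (cases "integrable M (\<lambda>x. h x * f x)")
    case True
    show ?thesis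
      by (rule order_trans[OF integral_norm_bound], rule integral_mono)
        (use True[THEN integrable_norm] L2_integrable[OF f, THEN integrable_norm] h in
          \<open>auto simp: norm_mult intro!: mult_right_mono\<close>)
  next
    \<comment> \<open>The integral of a non-integrable function is \<open>0\<close> by convention,
      and the right-hand side is nonnegative.\<close>
    case False
    then show ?thesis using \<open>0 \<le> C\<close> by (simp add: not_integrable_integral_eq)
  qed
  also have "\<dots> \<le> C * (sqrt (measure M (space M)) * l2_norm M f)"
    using L2_integral_norm_le[OF f] \<open>0 \<le> C\<close> by (simp add: mult_left_mono)
  finally show ?thesis by (simp add: mult.assoc)
qed

locale finite_real_measure = finite_measure M for M :: "real measure" +
  assumes measurable_id [measurable]: "(\<lambda>x. x) \<in> borel_measurable M"
begin

lemma kernel_measurable_pair: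
  assumes "bounded_kernel h"
  shows "(\<lambda>(x, t). h x t) \<in> borel_measurable (M \<Otimes>\<^sub>M M)"
    "(\<lambda>(x, t). h x t) \<in> borel_measurable (borel \<Otimes>\<^sub>M M)"
  unfolding split_beta' by (intro bounded_kernel_measurable[OF assms]; measurable)+

lemma kernel_op_integrable:
  assumes h: "bounded_kernel h" and f: "integrable M f"
  shows "integrable M (\<lambda>t. complex_of_real (h x t) * f t)"
proof -
  obtain C where C: "0 \<le> C" "\<And>x t. \<bar>h x t\<bar> \<le> C" using bounded_kernel_bound[OF h] by blast
  have [measurable]: "(\<lambda>t. h x t) \<in> borel_measurable M"
    by (intro bounded_kernel_measurable[OF h]) measurable
  show ?thesis
    by (rule Bochner_Integration.integrable_bound[of M "\<lambda>t. C * cmod (f t)"])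
      (use f C in \<open>auto simp: norm_mult intro!: mult_right_mono\<close>)
qed

lemma kernel_op_measurable:
  assumes h: "bounded_kernel h" and [measurable]: "f \<in> borel_measurable M"
  shows "kernel_op M h f \<in> borel_measurable M"
proof -
  note [measurable] = kernel_measurable_pair[OF h]
  show ?thesis unfolding kernel_op_def by measurable
qed

lemma kernel_op_bound:
  assumes "\<And>x t. \<bar>h x t\<bar> \<le> C" "0 \<le> C" "f \<in> L2 M"
  shows "cmod (kernel_op M h f x) \<le> C * sqrt (measure M (space M)) * l2_norm M f"
  unfolding kernel_op_def by (intro L2_integral_bounded_mult_le) (use assms in auto)

lemma kernel_op_L2: "bounded_kernel h \<Longrightarrow> f \<in> L2 M \<Longrightarrow> kernel_op M h f \<in> L2 M"
  by (rule bounded_kernel_bound, assumption,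
      rule L2_bounded(1)[OF kernel_op_measurable kernel_op_bound])
    (auto dest: L2_measurable)

lemma id_plus_L2: "bounded_kernel h \<Longrightarrow> f \<in> L2 M \<Longrightarrow> id_plus M h f \<in> L2 M"
  unfolding id_plus_def by (intro L2_add kernel_op_L2)

lemma kernel_op_add:
  assumes "bounded_kernel h" "integrable M f" "integrable M g"
  shows "kernel_op M h (\<lambda>t. f t + g t) x = kernel_op M h f x + kernel_op M h g x"
  by (simp add: kernel_op_def distrib_left kernel_op_integrable[OF assms(1)] assms(2,3))

lemma kernel_op_add_kernel:
  assumes "bounded_kernel h" "bounded_kernel k" "integrable M f"
  shows "kernel_op M (\<lambda>x t. h x t + k x t) f x = kernel_op M h f x + kernel_op M k f x"
  by (simp add: kernel_op_def distrib_right kernel_op_integrable assms)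

lemma kernel_op_cmult: "kernel_op M h (\<lambda>t. c * f t) x = c * kernel_op M h f x"
  by (simp add: kernel_op_def mult.left_commute)

text \<open>Composing kernels means applying the operator to each column of the second kernel. This
  moves facts between operators and kernels.\<close>

lemma kernel_op_of_real: "kernel_op M h (\<lambda>s. of_real (k s t)) x = of_real (kernel_comp M h k x t)"
  unfolding kernel_op_def kernel_comp_def integral_complex_of_real[symmetric] by simp

lemma bounded_kernel_comp:
  assumes h: "bounded_kernel h" and k: "bounded_kernel k"
  shows "bounded_kernel (kernel_comp M h k)"
proof -
  obtain C where C: "0 \<le> C" "\<And>x t. \<bar>h x t\<bar> \<le> C" using bounded_kernel_bound[OF h] by blast
  obtain D where D: "0 \<le> D" "\<And>x t. \<bar>k x t\<bar> \<le> D" using bounded_kernel_bound[OF k] by blast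
  have fst_id: "(\<lambda>p. fst (fst p)) \<in> borel_measurable ((borel \<Otimes>\<^sub>M borel) \<Otimes>\<^sub>M M)"
    and snd_id: "(\<lambda>p. snd (fst p)) \<in> borel_measurable ((borel \<Otimes>\<^sub>M borel) \<Otimes>\<^sub>M M)"
    and id: "(\<lambda>p. snd p) \<in> borel_measurable ((borel \<Otimes>\<^sub>M borel) \<Otimes>\<^sub>M M)"
    by (rule measurable_compose[OF measurable_fst measurable_fst]
        measurable_compose[OF measurable_fst measurable_snd]
        measurable_compose[OF measurable_snd measurable_id])+
  have "(\<lambda>(p, s). h (fst p) s * k s (snd p)) \<in> borel_measurable ((borel \<Otimes>\<^sub>M borel) \<Otimes>\<^sub>M M)"
    unfolding split_beta'
    by (rule borel_measurable_times[OF bounded_kernel_measurable[OF h fst_id id]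
          bounded_kernel_measurable[OF k id snd_id]])
  then have "(\<lambda>(x, t). kernel_comp M h k x t) \<in> borel_measurable (borel \<Otimes>\<^sub>M borel)"
    unfolding kernel_comp_def split_beta' by (intro borel_measurable_lebesgue_integral) simp
  moreover have "\<bar>kernel_comp M h k x t\<bar> \<le> C * D * measure M (space M)" for x t
  proof -
    have "norm (LINT s|M. h x s * k s t) \<le> (LINT s|M. C * D)"
    proof (cases "integrable M (\<lambda>s. h x s * k s t)")
      case True
      show ?thesis
        by (rule order_trans[OF integral_norm_bound], rule integral_mono)
          (use True[THEN integrable_abs] C D in \<open>auto simp: abs_mult intro!: mult_mono\<close>)
    next
      case False
      then show ?thesis using C D by (simp add: not_integrable_integral_eq)
    qed
    then show ?thesis by (simp add: kernel_comp_def mult_ac)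
  qed
  ultimately show ?thesis by (rule bounded_kernelI)
qed

lemma kernel_op_comp:
  assumes h: "bounded_kernel h" and k: "bounded_kernel k" and f: "integrable M f"
  shows "kernel_op M h (kernel_op M k f) x = kernel_op M (kernel_comp M h k) f x"
proof -
  interpret pair_sigma_finite M M ..
  obtain C where C: "0 \<le> C" "\<And>x t. \<bar>h x t\<bar> \<le> C" using bounded_kernel_bound[OF h] by blast
  obtain D where D: "0 \<le> D" "\<And>x t. \<bar>k x t\<bar> \<le> D" using bounded_kernel_bound[OF k] by blast
  have m: "(\<lambda>(s, t). complex_of_real (h x s * k s t)) \<in> borel_measurable (M \<Otimes>\<^sub>M M)"
    unfolding split_beta'
    by (intro measurable_compose[OF _ borel_measurable_of_real] borel_measurable_times
        bounded_kernel_measurable[OF h] bounded_kernel_measurable[OF k]) measurable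
  have "cmod (complex_of_real (h x s * k s t)) \<le> C * D" for s t
    using C D by (auto simp: norm_mult abs_mult intro!: mult_mono)
  from integrable_bounded_mult_prod[OF m this integrable_const f, of 1]
  have int: "integrable (M \<Otimes>\<^sub>M M) (\<lambda>(s, t). complex_of_real (h x s * k s t) * f t)"
    by simp
  have "kernel_op M h (kernel_op M k f) x
      = (LINT s|M. LINT t|M. complex_of_real (h x s * k s t) * f t)"
    by (simp add: kernel_op_def mult.assoc)
  also have "\<dots> = (LINT t|M. LINT s|M. complex_of_real (h x s * k s t) * f t)"
    by (rule Fubini_integral[OF int, symmetric])
  also have "\<dots> = kernel_op M (kernel_comp M h k) f x"
    unfolding kernel_op_def kernel_comp_def integral_complex_of_real [symmetric]
    by (simp del: of_real_mult integral_complex_of_real)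
  finally show ?thesis .
qed

lemma kernel_section_integrable:
  assumes "bounded_kernel h"
  shows "integrable M (\<lambda>s. complex_of_real (h s t))"
proof -
  obtain C where C: "0 \<le> C" "\<And>x t. \<bar>h x t\<bar> \<le> C" using bounded_kernel_bound[OF assms] by blast
  have "(\<lambda>s. h s t) \<in> borel_measurable M"
    by (intro bounded_kernel_measurable[OF assms]) measurable
  then show ?thesis by (intro integrable_const_bound[of _ C]) (use C in auto)
qed

text \<open>This is \<open>kernel_op_comp\<close> applied to a column of \<open>j\<close>.\<close>

lemma kernel_comp_assoc:
  assumes h: "bounded_kernel h" and k: "bounded_kernel k" and j: "bounded_kernel j"
  shows "kernel_comp M h (kernel_comp M k j) x t = kernel_comp M (kernel_comp M h k) j x t"
  using kernel_op_comp[OF h k kernel_section_integrable[OF j], of t x]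
  unfolding kernel_op_of_real of_real_eq_iff .

lemma kernel_comp_integrable:
  assumes h: "bounded_kernel h" and k: "bounded_kernel k"
  shows "integrable M (\<lambda>s. h x s * k s t)"
proof -
  have "integrable M (\<lambda>s. complex_of_real (h x s) * complex_of_real (k s t))"
    by (rule kernel_op_integrable[OF h kernel_section_integrable[OF k]])
  then have "integrable M (\<lambda>s. complex_of_real (h x s * k s t))" by simp
  then show ?thesis unfolding complex_of_real_integrable_eq .
qed

lemma kernel_comp_add_right:
  assumes "bounded_kernel h" "bounded_kernel k" "bounded_kernel j"
  shows "kernel_comp M j (\<lambda>x t. h x t + k x t) x t = kernel_comp M j h x t + kernel_comp M j k x t"
  unfolding kernel_comp_def by (simp add: distrib_left kernel_comp_integrable assms)

lemma kernel_comp_transpose: "kernel_comp M (\<lambda>x t. h t x) (\<lambda>x t. k t x) x t = kernel_comp M k h t x"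
  by (simp add: kernel_comp_def mult.commute)

text \<open>Operators of the form identity plus kernel are closed under products. The identity holds
  at every point, so equations between kernels become pointwise equations between operators.\<close>

lemma id_plus_id_plus:
  assumes h: "bounded_kernel h" and k: "bounded_kernel k" and f: "f \<in> L2 M"
  shows "id_plus M h (id_plus M k f) x
    = id_plus M (\<lambda>x t. h x t + k x t + kernel_comp M h k x t) f x"
proof -
  have i: "integrable M f" "integrable M (kernel_op M k f)"
    using f kernel_op_L2[OF k f] L2_integrable by auto
  show ?thesis
    by (simp add: id_plus_def kernel_op_add h k i kernel_op_comp kernel_op_add_kernel
        bounded_kernel_add bounded_kernel_comp)
qed

lemma bounded_op_kernel_op:
  assumes h: "bounded_kernel h" shows "bounded_op M (kernel_op M h)"
proof -
  obtain C where C: "0 \<le> C" "\<And>x t. \<bar>h x t\<bar> \<le> C" using bounded_kernel_bound[OF h] by blast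
  define m where "m = sqrt (measure M (space M))"
  have "l2_norm M (kernel_op M h f) \<le> (C * m * m) * l2_norm M f" if f: "f \<in> L2 M" for f
  proof -
    have "l2_norm M (kernel_op M h f) \<le> \<bar>C * m * l2_norm M f\<bar> * m"
      unfolding m_def
      by (intro L2_bounded(2) kernel_op_measurable[OF h] kernel_op_bound C f L2_measurable)
    then show ?thesis using C by (simp add: m_def abs_mult mult_ac)
  qed
  then show ?thesis
    unfolding bounded_op_def
    by (auto simp: kernel_op_L2[OF h] kernel_op_add[OF h] L2_integrable kernel_op_cmult)
qed

lemma bounded_op_id_plus:
  assumes h: "bounded_kernel h" shows "bounded_op M (id_plus M h)"
proof -
  obtain D where D: "\<And>f. f \<in> L2 M \<Longrightarrow> l2_norm M (kernel_op M h f) \<le> D * l2_norm M f"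
    using bounded_op_kernel_op[OF h] unfolding bounded_op_def by blast
  have "l2_norm M (id_plus M h f) \<le> sqrt (2 + 2 * D\<^sup>2) * l2_norm M f" if f: "f \<in> L2 M" for f
  proof -
    let ?g = "kernel_op M h f"
    have g: "?g \<in> L2 M" by (rule kernel_op_L2[OF h f])
    have "(l2_norm M (id_plus M h f))\<^sup>2 \<le> (LINT x|M. 2 * (cmod (f x))\<^sup>2 + 2 * (cmod (?g x))\<^sup>2)"
      unfolding l2_norm_sq using id_plus_L2[OF h f] f g
      by (intro integral_mono) (auto simp: L2_integrable_sq id_plus_def cmod_add_sq_le)
    also have "\<dots> = 2 * (l2_norm M f)\<^sup>2 + 2 * (l2_norm M ?g)\<^sup>2"
      using f g by (simp add: L2_integrable_sq l2_norm_sq)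
    also have "\<dots> \<le> 2 * (l2_norm M f)\<^sup>2 + 2 * (D * l2_norm M f)\<^sup>2"
      using D[OF f] by (simp add: power_mono)
    also have "\<dots> = (sqrt (2 + 2 * D\<^sup>2) * l2_norm M f)\<^sup>2"
      by (simp add: power_mult_distrib algebra_simps)
    finally show ?thesis by (rule power2_le_imp_le) simp
  qed
  then have "\<exists>C. \<forall>f\<in>L2 M. l2_norm M (id_plus M h f) \<le> C * l2_norm M f" by blast
  moreover have "id_plus M h (\<lambda>y. f y + g y) x = id_plus M h f x + id_plus M h g x"
    if "f \<in> L2 M" "g \<in> L2 M" for f g x
    using that by (simp add: id_plus_def kernel_op_add[OF h] L2_integrable)
  moreover have "id_plus M h (\<lambda>y. c * f y) x = c * id_plus M h f x" for c f x
    by (simp add: id_plus_def kernel_op_cmult distrib_left)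
  ultimately show ?thesis
    unfolding bounded_op_def using id_plus_L2[OF h] by auto
qed

text \<open>Fubini; the kernel is real, so conjugation leaves it alone and the adjoint is the plain
  transpose.\<close>

lemma kernel_op_adjoint:
  assumes h: "bounded_kernel h" and f: "f \<in> L2 M" and g: "g \<in> L2 M"
  shows "l2_inner M (kernel_op M h f) g = l2_inner M f (kernel_op M (\<lambda>x t. h t x) g)"
proof -
  interpret pair_sigma_finite M M ..
  obtain C where C: "0 \<le> C" "\<And>x t. \<bar>h x t\<bar> \<le> C" using bounded_kernel_bound[OF h] by blast
  have m: "(\<lambda>(x, t). complex_of_real (h x t)) \<in> borel_measurable (M \<Otimes>\<^sub>M M)"
    unfolding split_beta'
    by (intro measurable_compose[OF _ borel_measurable_of_real]
        bounded_kernel_measurable[OF h]) measurable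
  have int: "integrable (M \<Otimes>\<^sub>M M) (\<lambda>(x, t). complex_of_real (h x t) * (cnj (g x) * f t))"
    using integrable_bounded_mult_prod[OF m, of C "\<lambda>x. cnj (g x)" f] C
      L2_integrable[OF f] L2_integrable[OF L2_cnj[OF g]] by simp
  have "l2_inner M (kernel_op M h f) g = (LINT x|M. LINT t|M. complex_of_real (h x t) * (cnj (g x) * f t))"
    unfolding l2_inner_def kernel_op_def integral_mult_left_zero [symmetric] by (simp only: mult_ac)
  also have "\<dots> = (LINT t|M. LINT x|M. complex_of_real (h x t) * (cnj (g x) * f t))"
    by (rule Fubini_integral[OF int, symmetric])
  also have "\<dots> = l2_inner M f (kernel_op M (\<lambda>x t. h t x) g)"
    unfolding l2_inner_def kernel_op_def
    by (simp add: mult_ac flip: integral_mult_right_zero Bochner_Integration.integral_cnj)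
  finally show ?thesis .
qed

lemma adjoint_ops_id_plus:
  assumes h: "bounded_kernel h"
  shows "adjoint_ops M (id_plus M h) (id_plus M (\<lambda>x t. h t x))"
  using bounded_op_id_plus[OF h] bounded_op_id_plus[OF bounded_kernel_transpose[OF h]]
  unfolding adjoint_ops_def id_plus_def
  by (auto simp: l2_inner_add_left l2_inner_add_right kernel_op_L2 h bounded_kernel_transpose
      kernel_op_adjoint)

end

section \<open>Fourier transforms on a bounded interval\<close>

text \<open>Passes from the Lebesgue integral over the open interval to the gauge integral over the
  closed one, where the fundamental theorem of calculus is available.\<close>

lemma lint_interval_measure:
  fixes g :: "real \<Rightarrow> 'b::euclidean_space"
  assumes "continuous_on {c..d} g"
  shows "(LINT x|interval_measure_on c d. g x) = integral {c..d} g"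
    and "integrable (interval_measure_on c d) g"
proof -
  have ab: "set_integrable lborel {c..d} g"
    by (rule borel_integrable_compact[OF _ assms, folded set_integrable_def]) simp
  then have si: "set_integrable lborel {c<..<d} g"
    by (rule set_integrable_subset) auto
  have "(LINT x|interval_measure_on c d. g x) = (LINT x:{c<..<d}|lborel. g x)"
    unfolding interval_measure_on_def set_lebesgue_integral_def
    by (subst integral_restrict_space) auto
  also have "\<dots> = integral {c<..<d} g"
    by (rule set_borel_integral_eq_integral(2)[OF si])
  also have "\<dots> = integral {c..d} g"
    by (simp add: integral_open_interval_real)
  finally show "(LINT x|interval_measure_on c d. g x) = integral {c..d} g" .
  show "integrable (interval_measure_on c d) g"
    unfolding interval_measure_on_def using si
    by (subst integrable_restrict_space) (auto simp: set_integrable_def)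
qed

text \<open>Cuts a long interval into \<open>N\<close> cells of length \<open>h\<close> and
  translates each onto the first, so that a bound for sums over a lattice can be integrated over a
  single cell.\<close>

lemma integral_periodize:
  fixes g :: "real \<Rightarrow> real"
  assumes g: "continuous_on UNIV g" and h: "0 \<le> h"
  shows "integral {c..c + real N * h} g = integral {c..c + h} (\<lambda>x. \<Sum>k<N. g (x + real k * h))"
proof (induction N)
  case (Suc N)
  have cont: "continuous_on S g" for S by (rule continuous_on_subset[OF g]) simp
  have cont': "continuous_on S (\<lambda>x. g (x + u))" for S u
    by (rule continuous_on_compose2[OF g]) (auto intro: continuous_intros)
  have "integral {c..c + real (Suc N) * h} g
      = integral {c..c + real N * h} g + integral {c + real N * h..c + real (Suc N) * h} g"
    by (rule Henstock_Kurzweil_Integration.integral_combine[symmetric])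
      (use h in \<open>auto simp: mult_right_mono intro: integrable_continuous_interval cont\<close>)
  also have "integral {c + real N * h..c + real (Suc N) * h} g = integral {c..c + h} (\<lambda>x. g (x + real N * h))"
    using integral_shift_Icc_real[of c "c + h" g "real N * h"]
    by (simp add: o_def distrib_right add_ac)
  also have "integral {c..c + real N * h} g + \<dots>
      = integral {c..c + h} (\<lambda>x. (\<Sum>k<N. g (x + real k * h)) + g (x + real N * h))"
    unfolding Suc.IH
    by (rule integral_add[symmetric])
      (intro integrable_continuous_interval continuous_intros cont')+
  finally show ?case by simp
qed simp

text \<open>The argument is complex because the transform is later used as an entire function. There
  is no normalising factor, whence the \<open>2 * pi\<close> in Plancherel's inequality.\<close>

definition fourier :: "real measure \<Rightarrow> (real \<Rightarrow> complex) \<Rightarrow> complex \<Rightarrow> complex" where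
  "fourier M f z = (LINT t|M. exp (- \<i> * z * of_real t) * f t)"

section \<open>Entire Fourier transforms and the Plancherel inequality\<close>

locale bounded_interval =
  fixes a \<zeta> :: real
  assumes a_less: "a < \<zeta>"
begin

abbreviation M where "M \<equiv> interval_measure_on a \<zeta>"

abbreviation R where "R \<equiv> max \<bar>a\<bar> \<bar>\<zeta>\<bar>"

lemma space_M: "space M = {a<..<\<zeta>}"
  by (simp add: interval_measure_on_def space_restrict_space)

lemma emeasure_M: "emeasure M (space M) = ennreal (\<zeta> - a)"
  unfolding space_M unfolding interval_measure_on_def using a_less
  by (subst emeasure_restrict_space) auto

sublocale finite_real_measure "interval_measure_on a \<zeta>"
proof (intro finite_real_measure.intro finite_real_measure_axioms.intro finite_measureI)
  show "emeasure M (space M) \<noteq> \<infinity>" by (simp add: emeasure_M)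
  show "(\<lambda>x. x) \<in> borel_measurable M"
    unfolding interval_measure_on_def by (rule measurable_restrict_space1) simp
qed

lemma measure_M: "measure M (space M) = \<zeta> - a"
  using a_less by (simp add: measure_def emeasure_M)

lemma abs_le_R: "t \<in> space M \<Longrightarrow> \<bar>t\<bar> \<le> R"
  by (auto simp: space_M)

lemma cmod_exp_le:
  assumes "t \<in> space M" shows "cmod (exp (- \<i> * z * of_real t)) \<le> exp (R * cmod z)"
proof -
  have "cmod (exp (- \<i> * z * of_real t)) \<le> exp (cmod (- \<i> * z * of_real t))"
    by (rule norm_exp)
  also have "cmod (- \<i> * z * of_real t) = \<bar>t\<bar> * cmod z"
    by (simp add: norm_mult)
  also have "\<dots> \<le> R * cmod z"
    by (rule mult_right_mono[OF abs_le_R[OF assms]]) simp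
  finally show ?thesis by simp
qed

lemma cmod_fourier_le:
  assumes "f \<in> L2 M"
  shows "cmod (fourier M f z) \<le> exp (R * cmod z) * sqrt (\<zeta> - a) * l2_norm M f"
  unfolding fourier_def measure_M[symmetric]
  by (rule L2_integral_bounded_mult_le[OF assms cmod_exp_le]) auto

lemma cmod_fourier_real_le:
  assumes "f \<in> L2 M"
  shows "cmod (fourier M f (of_real \<xi>)) \<le> sqrt (\<zeta> - a) * l2_norm M f"
  using L2_integral_bounded_mult_le[OF assms, of "\<lambda>t. exp (- \<i> * of_real \<xi> * of_real t)" 1]
  by (simp add: fourier_def measure_M)

text \<open>Integrates the exponential series term by term, with majorant
  \<open>(R * cmod z) ^ n / fact n * cmod (f t)\<close>. Convergence at every \<open>z\<close> makes
  the transform entire.\<close>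

lemma fourier_sums:
  assumes f: "f \<in> L2 M"
  shows "(\<lambda>n. (LINT t|M. (- \<i> * of_real t) ^ n / fact n * f t) * z ^ n) sums fourier M f z"
proof -
  define u where "u n t = (- \<i> * z * of_real t) ^ n / fact n * f t" for n t
  have fi: "integrable M f" by (rule L2_integrable[OF f])
  then have [measurable]: "f \<in> borel_measurable M" by simp
  have u_le: "norm (u n t) \<le> (R * cmod z) ^ n / fact n * cmod (f t)" if "t \<in> space M" for n t
  proof -
    have "norm (u n t) = (\<bar>t\<bar> * cmod z) ^ n / fact n * cmod (f t)"
      by (simp add: u_def norm_mult norm_divide norm_power mult.commute)
    also have "\<dots> \<le> (R * cmod z) ^ n / fact n * cmod (f t)"
      by (intro mult_right_mono divide_right_mono power_mono abs_le_R[OF that]) simp_all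
    finally show ?thesis .
  qed
  have int: "integrable M (u n)" for n
  proof (rule Bochner_Integration.integrable_bound)
    show "integrable M (\<lambda>t. (R * cmod z) ^ n / fact n * cmod (f t))" using fi by simp
    show "u n \<in> borel_measurable M" unfolding u_def by measurable
    show "AE t in M. norm (u n t) \<le> norm ((R * cmod z) ^ n / fact n * cmod (f t))"
      using order_trans[OF u_le abs_ge_self] by (intro AE_I2) simp
  qed
  have sR: "summable (\<lambda>n. (R * cmod z) ^ n / fact n * C)" for C
    by (rule summable_mult2) (use summable_exp[of "R * cmod z"] in \<open>simp only: divide_inverse mult.commute\<close>)
  have s1: "summable (\<lambda>n. norm (u n t))" if "t \<in> space M" for t
    by (rule summable_comparison_test'[OF sR]) (use u_le[OF that] in simp)
  have s2: "summable (\<lambda>n. LINT t|M. norm (u n t))"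
  proof (rule summable_comparison_test'[OF sR])
    fix n :: nat assume "0 \<le> n"
    have "(LINT t|M. norm (u n t)) \<le> (LINT t|M. (R * cmod z) ^ n / fact n * cmod (f t))"
      by (rule integral_mono) (use int fi u_le in auto)
    then show "norm (LINT t|M. norm (u n t)) \<le> (R * cmod z) ^ n / fact n * (LINT t|M. cmod (f t))"
      by simp
  qed
  have "(\<lambda>n. integral\<^sup>L M (u n)) sums (LINT t|M. (\<Sum>n. u n t))"
    by (rule sums_integral[OF int _ s2]) (use s1 in auto)
  moreover have "(LINT t|M. (\<Sum>n. u n t)) = fourier M f z"
    unfolding fourier_def
  proof (rule Bochner_Integration.integral_cong)
    fix t
    have "(\<lambda>n. (- \<i> * z * of_real t) ^ n /\<^sub>R fact n * f t) sums (exp (- \<i> * z * of_real t) * f t)"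
      by (intro sums_mult2 exp_converges)
    then have "(\<lambda>n. u n t) sums (exp (- \<i> * z * of_real t) * f t)"
      by (simp add: u_def scaleR_conv_of_real divide_inverse mult_ac)
    then show "(\<Sum>n. u n t) = exp (- \<i> * z * of_real t) * f t" by (rule sums_unique[symmetric])
  qed simp
  moreover have "integral\<^sup>L M (u n) = (LINT t|M. (- \<i> * of_real t) ^ n / fact n * f t) * z ^ n" for n
  proof -
    have "(- \<i> * z * of_real t) ^ n = (- \<i> * of_real t) ^ n * z ^ n" for t
      by (simp only: mult_ac flip: power_mult_distrib)
    then show ?thesis unfolding u_def integral_mult_left_zero [symmetric] by (simp add: mult_ac)
  qed
  ultimately show ?thesis by simp
qed

lemma fourier_holomorphic:
  assumes "f \<in> L2 M" shows "fourier M f holomorphic_on UNIV"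
proof -
  have "fourier M f holomorphic_on ball 0 r" for r
    by (rule power_series_holomorphic, unfold diff_zero, rule fourier_sums[OF assms])
  then have "fourier M f field_differentiable (at z)" for z
    by (rule holomorphic_on_imp_differentiable_at[of _ "ball 0 (cmod z + 1)"]) auto
  then show ?thesis by (simp add: holomorphic_on_def field_differentiable_at_within)
qed

lemma fourier_continuous [continuous_intros]:
  assumes "f \<in> L2 M" shows "continuous_on S (\<lambda>\<xi>. fourier M f (of_real \<xi>))"
  using holomorphic_on_imp_continuous_on[OF fourier_holomorphic[OF assms]]
  by (rule continuous_on_compose2) (auto intro: continuous_intros)

text \<open>
  Bessel's inequality for the exponentials of period \<open>\<zeta> - a\<close>, integrated over one cell of the dual
  lattice, gives the Plancherel inequality without any Fourier inversion.
\<close>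

lemma fourier_Bessel:
  assumes f: "f \<in> L2 M"
  shows "(\<Sum>k<N. (cmod (fourier M f (of_real (\<xi> + real k * (2 * pi / (\<zeta> - a))))))\<^sup>2)
    \<le> (\<zeta> - a) * (l2_norm M f)\<^sup>2"
proof -
  define l where "l = \<zeta> - a"
  have l: "l > 0" using a_less by (simp add: l_def)
  define w where "w k = 2 * pi * real k / l" for k :: nat
  define e where "e k t = exp (\<i> * of_real (w k * t)) / of_real (sqrt l)" for k :: nat and t :: real
  \<comment> \<open>Modulating \<open>f\<close> absorbs the shift \<open>\<xi>\<close>, so the
    unshifted lattice exponentials \<open>e k\<close> serve for every \<open>\<xi>\<close>.\<close>
  define g where "g t = exp (- \<i> * of_real (\<xi> * t)) * f t" for t
  have [measurable]: "f \<in> borel_measurable M" by (rule L2_measurable[OF f])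
  have g: "g \<in> L2 M"
    by (rule l2_norm_bound(1)[OF _ f]) (auto simp: g_def[abs_def] norm_mult)
  have ng: "l2_norm M g = l2_norm M f"
    by (simp add: l2_norm_def g_def norm_mult)
  have e: "e k \<in> L2 M" for k
    by (rule L2_bounded(1)[of _ "1 / sqrt l"]) (use l in \<open>auto simp: e_def[abs_def] norm_divide\<close>)
  have orth: "l2_inner M (e j) (e k) = (if j = k then 1 else 0)" for j k
  proof -
    define v where "v = w j - w k"
    have "e j t * cnj (e k t) = exp (\<i> * of_real (v * t)) / of_real l" for t
      using l by (simp add: e_def v_def exp_cnj left_diff_distrib right_diff_distrib exp_diff
          exp_minus field_simps flip: of_real_mult)
    then have "l2_inner M (e j) (e k) = (LINT t|M. exp (\<i> * of_real (v * t))) / of_real l"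
      by (simp add: l2_inner_def)
    also have "(LINT t|M. exp (\<i> * of_real (v * t))) = integral {a..\<zeta>} (\<lambda>t. exp (\<i> * of_real (v * t)))"
      by (rule lint_interval_measure) (intro continuous_intros)
    also have "\<dots> = (if j = k then of_real l else 0)"
    proof (cases "j = k")
      case True
      then show ?thesis using a_less by (simp add: v_def l_def of_real_def)
    next
      case False
      then have v: "v \<noteq> 0" using l by (simp add: v_def w_def field_simps)
      define P where "P t = exp (\<i> * of_real (v * t)) / (\<i> * of_real v)" for t
      have "(P has_vector_derivative exp (\<i> * of_real (v * t))) (at t within {a..\<zeta>})" for t
        unfolding P_def using v
        by (auto intro!: derivative_eq_intros has_vector_derivative_real_field
            simp: field_simps)
      then have "((\<lambda>t. exp (\<i> * of_real (v * t))) has_integral (P \<zeta> - P a)) {a..\<zeta>}"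
        using a_less by (intro fundamental_theorem_of_calculus) auto
      \<comment> \<open>\<open>v\<close> is a multiple of \<open>2 * pi / l\<close>, so the
        antiderivative has period \<open>l\<close>, the length of the interval.\<close>
      moreover have "P \<zeta> = P a"
      proof -
        have "v * l = 2 * pi * of_int (int j - int k)"
          using l by (simp add: v_def w_def field_simps)
        then have "v * \<zeta> = v * a + 2 * pi * of_int (int j - int k)"
          by (simp add: l_def right_diff_distrib)
        then have "\<i> * of_real (v * \<zeta>)
            = \<i> * of_real (v * a) + \<i> * (of_int (int j - int k) * (of_real pi * 2))"
          by (simp only: of_real_add of_real_mult of_real_of_int_eq of_real_numeral distrib_left mult_ac)
        then show ?thesis unfolding P_def by (simp only: exp_plus_2pin)
      qed
      ultimately show ?thesis using False by (simp add: integral_unique)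
    qed
    finally show ?thesis using l by auto
  qed
  have F: "fourier M f (of_real (\<xi> + real k * (2 * pi / l))) = of_real (sqrt l) * l2_inner M g (e k)" for k
  proof -
    have "g t * cnj (e k t) = exp (- \<i> * of_real (\<xi> + real k * (2 * pi / l)) * of_real t) * f t / of_real (sqrt l)" for t
      by (simp add: g_def e_def w_def exp_cnj algebra_simps flip: exp_add)
    then have "l2_inner M g (e k) = fourier M f (of_real (\<xi> + real k * (2 * pi / l))) / of_real (sqrt l)"
      by (simp add: l2_inner_def fourier_def)
    then show ?thesis using l by simp
  qed
  have "(\<Sum>k<N. (cmod (fourier M f (of_real (\<xi> + real k * (2 * pi / l)))))\<^sup>2)
      = l * (\<Sum>k<N. (cmod (l2_inner M g (e k)))\<^sup>2)"
    unfolding F using l by (simp add: norm_mult power_mult_distrib sum_distrib_left)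
  also have "\<dots> \<le> l * (l2_norm M g)\<^sup>2"
    using l by (intro mult_left_mono L2_Bessel g e orth) auto
  finally show ?thesis by (simp add: ng l_def)
qed

text \<open>The interval is enlarged to finitely many cells and folded onto one. There
  \<open>fourier_Bessel\<close> bounds the integrand by a constant, whose factor
  \<open>\<zeta> - a\<close> cancels against the cell length
  \<open>2 * pi / (\<zeta> - a)\<close>.\<close>

lemma fourier_Plancherel_le:
  assumes f: "f \<in> L2 M"
  shows "integral {c..d} (\<lambda>\<xi>. (cmod (fourier M f (of_real \<xi>)))\<^sup>2) \<le> 2 * pi * (l2_norm M f)\<^sup>2"
proof -
  define h where "h = 2 * pi / (\<zeta> - a)"
  define g where "g \<xi> = (cmod (fourier M f (of_real \<xi>)))\<^sup>2" for \<xi>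
  have h: "h > 0" using a_less by (simp add: h_def)
  have g: "continuous_on S g" for S
    unfolding g_def by (intro continuous_intros f)
  have g': "continuous_on S (\<lambda>x. g (x + u))" for S u
    by (rule continuous_on_compose2[OF g[of UNIV]]) (auto intro: continuous_intros)
  obtain N :: nat where N: "d \<le> c + real N * h"
    using reals_Archimedean3[OF h] by (metis add_le_cancel_left diff_add_cancel less_eq_real_def add.commute)
  have "integral {c..d} g \<le> integral {c..c + real N * h} g"
    by (intro integral_subset_le integrable_continuous_interval g) (use N in \<open>auto simp: g_def\<close>)
  also have "\<dots> = integral {c..c + h} (\<lambda>x. \<Sum>k<N. g (x + real k * h))"
    using h by (intro integral_periodize g) simp
  also have "\<dots> \<le> integral {c..c + h} (\<lambda>x. (\<zeta> - a) * (l2_norm M f)\<^sup>2)"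
    using fourier_Bessel[OF f]
    by (intro integral_le integrable_continuous_interval continuous_intros g') (auto simp: g_def h_def)
  also have "\<dots> = 2 * pi * (l2_norm M f)\<^sup>2"
    using h a_less by (simp add: h_def)
  finally show ?thesis by (simp add: g_def[abs_def])
qed

end

section \<open>Concentration of the Fourier transform\<close>

text \<open>Direct integration off the diagonal. On the diagonal the integrand is 1 and the integral
  is 2, which matches the value \<open>1 / pi\<close> chosen in \<open>sine_kernel\<close>.\<close>

lemma sine_kernel_fourier:
  "complex_of_real (sine_kernel x t)
    = (LINT \<xi>|interval_measure_on (- 1) 1. exp (\<i> * of_real \<xi> * of_real (x - t))) / (2 * of_real pi)"
proof -
  define u where "u = x - t"
  have "(LINT \<xi>|interval_measure_on (- 1) 1. exp (\<i> * of_real \<xi> * of_real u))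
      = integral {- 1..1} (\<lambda>\<xi>. exp (\<i> * of_real \<xi> * of_real u))"
    by (rule lint_interval_measure) (intro continuous_intros)
  also have "\<dots> = 2 * of_real pi * of_real (sine_kernel x t)"
  proof (cases "u = 0")
    case True
    then show ?thesis by (simp add: sine_kernel_def u_def scaleR_conv_of_real)
  next
    case False
    define P where "P \<xi> = exp (\<i> * of_real \<xi> * of_real u) / (\<i> * of_real u)" for \<xi> :: real
    have "(P has_vector_derivative exp (\<i> * of_real \<xi> * of_real u)) (at \<xi> within {- 1..1})" for \<xi>
      unfolding P_def using False
      by (auto intro!: derivative_eq_intros has_vector_derivative_real_field simp: field_simps)
    then have "((\<lambda>\<xi>. exp (\<i> * of_real \<xi> * of_real u)) has_integral (P 1 - P (- 1))) {- 1..1}"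
      by (intro fundamental_theorem_of_calculus) auto
    moreover have "P 1 - P (- 1) = 2 * of_real (sin u / u)"
    proof -
      have "P 1 - P (- 1) = (cis u - cis (- u)) / (\<i> * of_real u)"
        by (simp add: P_def cis_conv_exp diff_divide_distrib)
      also have "cis u - cis (- u) = 2 * \<i> * of_real (sin u)"
        by (simp add: complex_eq_iff)
      finally show ?thesis by simp
    qed
    ultimately show ?thesis using False by (simp add: sine_kernel_def u_def integral_unique)
  qed
  finally show ?thesis by (simp add: u_def)
qed

lemma abs_sine_kernel_le: "\<bar>sine_kernel x t\<bar> \<le> 1 / pi"
proof (cases "x = t")
  case False
  have "\<bar>sin (x - t)\<bar> / (pi * \<bar>x - t\<bar>) \<le> \<bar>x - t\<bar> / (pi * \<bar>x - t\<bar>)"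
    by (intro divide_right_mono abs_sin_x_le_abs_x) simp
  then show ?thesis using False by (simp add: sine_kernel_def abs_mult)
qed (simp add: sine_kernel_def)

lemma sine_kernel_sym: "sine_kernel x t = sine_kernel t x"
  using sin_minus[of "x - t"] by (auto simp: sine_kernel_def divide_simps) (simp add: algebra_simps)

lemma bounded_kernel_sine: "bounded_kernel (\<lambda>x t. c * sine_kernel x t)"
proof (rule bounded_kernelI)
  show "(\<lambda>(x, t). c * sine_kernel x t) \<in> borel_measurable (borel \<Otimes>\<^sub>M borel)"
    unfolding sine_kernel_def by measurable
  show "\<bar>c * sine_kernel x t\<bar> \<le> \<bar>c\<bar> * (1 / pi)" for x t
    unfolding abs_mult by (intro mult_left_mono abs_sine_kernel_le) simp
qed

text \<open>The frequency band is itself a bounded interval, so the finite-measure results above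
  apply to functions of \<open>\<xi>\<close> as well.\<close>

interpretation freq: bounded_interval "- 1" 1
  by unfold_locales simp

abbreviation freq_measure where "freq_measure \<equiv> interval_measure_on (- 1) 1"

context bounded_interval
begin

abbreviation F where "F f \<equiv> \<lambda>\<xi>::real. fourier M f (of_real \<xi>)"

abbreviation K where "K \<equiv> kernel_op M sine_kernel"

lemma sine_kernel_bounded: "bounded_kernel sine_kernel"
  using bounded_kernel_sine[of 1] by simp

lemma fourier_freq_integrable:
  assumes "f \<in> L2 M" shows "integrable freq_measure (F f)"
  by (intro lint_interval_measure(2) continuous_intros assms)

lemma fourier_freq_L2:
  assumes "f \<in> L2 M" shows "F f \<in> L2 freq_measure"
  by (rule freq.L2_bounded(1)[OF borel_measurable_integrable[OF fourier_freq_integrable[OF assms]]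
        cmod_fourier_real_le[OF assms]])

lemma fourier_freq_norm:
  assumes "f \<in> L2 M"
  shows "(l2_norm freq_measure (F f))\<^sup>2 = integral {- 1..1} (\<lambda>\<xi>. (cmod (F f \<xi>))\<^sup>2)"
  unfolding l2_norm_sq by (intro lint_interval_measure(1) continuous_intros assms)

lemma sine_op_fourier:
  assumes f: "f \<in> L2 M"
  shows "K f x = (LINT \<xi>|freq_measure. exp (\<i> * of_real \<xi> * of_real x) * F f \<xi>) / (2 * of_real pi)"
proof -
  interpret pair_sigma_finite M freq_measure ..
  define H where "H t \<xi> = exp (\<i> * of_real \<xi> * of_real (x - t))" for t \<xi> :: real
  have "(\<lambda>(t, \<xi>). H t \<xi>) \<in> borel_measurable (M \<Otimes>\<^sub>M freq_measure)"
    unfolding H_def using freq.measurable_id [measurable] by measurable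
  from integrable_bounded_mult_prod[OF this _ L2_integrable[OF f] freq.integrable_const[of 1], of 1]
  have int: "integrable (M \<Otimes>\<^sub>M freq_measure) (\<lambda>(t, \<xi>). H t \<xi> * f t)"
    by (simp add: H_def)
  have "K f x = (LINT t|M. (LINT \<xi>|freq_measure. H t \<xi> * f t)) / (2 * of_real pi)"
    unfolding kernel_op_def sine_kernel_fourier H_def by simp
  also have "(LINT t|M. (LINT \<xi>|freq_measure. H t \<xi> * f t)) = (LINT \<xi>|freq_measure. LINT t|M. H t \<xi> * f t)"
    by (rule Fubini_integral[OF int, symmetric])
  also have "\<dots> = (LINT \<xi>|freq_measure. exp (\<i> * of_real \<xi> * of_real x) * F f \<xi>)"
    unfolding fourier_def integral_mult_right_zero [symmetric] H_def
    by (simp add: algebra_simps flip: exp_add)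
  finally show ?thesis .
qed

text \<open>Up to the factor \<open>1 / (2 * pi)\<close>, \<open>K\<close> is the adjoint of the map
  \<open>F\<close> into the frequency band composed with \<open>F\<close>. Positivity, the norm
  bound and the trace bound all rest on this.\<close>

lemma sine_op_inner:
  assumes f: "f \<in> L2 M" and g: "g \<in> L2 M"
  shows "l2_inner M (K f) g = l2_inner freq_measure (F f) (F g) / (2 * of_real pi)"
proof -
  interpret pair_sigma_finite M freq_measure ..
  define H where "H x \<xi> = exp (\<i> * of_real \<xi> * of_real x)" for x \<xi> :: real
  have "(\<lambda>(x, \<xi>). H x \<xi>) \<in> borel_measurable (M \<Otimes>\<^sub>M freq_measure)"
    unfolding H_def using freq.measurable_id [measurable] by measurable
  from integrable_bounded_mult_prod[OF this _ L2_integrable[OF L2_cnj[OF g]] fourier_freq_integrable[OF f], of 1]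
  have int: "integrable (M \<Otimes>\<^sub>M freq_measure) (\<lambda>(x, \<xi>). H x \<xi> * (cnj (g x) * F f \<xi>))"
    by (simp add: H_def)
  have "l2_inner M (K f) g = (LINT x|M. (LINT \<xi>|freq_measure. H x \<xi> * (cnj (g x) * F f \<xi>))) / (2 * of_real pi)"
    by (simp add: l2_inner_def sine_op_fourier[OF f] H_def mult_ac flip: integral_mult_left_zero)
  also have "(LINT x|M. (LINT \<xi>|freq_measure. H x \<xi> * (cnj (g x) * F f \<xi>)))
      = (LINT \<xi>|freq_measure. LINT x|M. H x \<xi> * (cnj (g x) * F f \<xi>))"
    by (rule Fubini_integral[OF int, symmetric])
  also have "\<dots> = l2_inner freq_measure (F f) (F g)"
  proof -
    have "(LINT x|M. H x \<xi> * (cnj (g x) * F f \<xi>)) = F f \<xi> * cnj (F g \<xi>)" for \<xi>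
    proof -
      have "cnj (F g \<xi>) = (LINT x|M. H x \<xi> * cnj (g x))"
        unfolding fourier_def H_def Bochner_Integration.integral_cnj [symmetric] by (simp add: exp_cnj)
      then show ?thesis
        by (simp add: mult_ac flip: integral_mult_right_zero)
    qed
    then show ?thesis by (simp add: l2_inner_def)
  qed
  finally show ?thesis .
qed

text \<open>
  Strictness comes from analyticity: near-extremal functions would have Fourier transforms that
  converge, by Montel's theorem, to an entire function vanishing on \<open>[1, 2]\<close> with full mass
  on \<open>[-1, 1]\<close>.
\<close>

lemma fourier_concentration_lt:
  "\<exists>q. 0 \<le> q \<and> q < 1 \<and>
    (\<forall>f\<in>L2 M. integral {- 1..1} (\<lambda>\<xi>. (cmod (F f \<xi>))\<^sup>2) \<le> 2 * pi * q * (l2_norm M f)\<^sup>2)"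
proof (rule ccontr)
  \<comment> \<open>These candidate constants start at 0 and tend to 1; if the claim fails, each is
    violated by some \<open>f n\<close>.\<close>
  define q where "q n = 1 - 1 / real (Suc n)" for n
  have q: "0 \<le> q n" "q n < 1" for n by (simp_all add: q_def)
  define E where "E c d h = integral {c..d} (\<lambda>\<xi>. (cmod (h (complex_of_real \<xi>)))\<^sup>2)" for c d :: real and h
  assume "\<not> ?thesis"
  then have "\<exists>f\<in>L2 M. 2 * pi * q n * (l2_norm M f)\<^sup>2 < E (- 1) 1 (fourier M f)" for n
    using q[of n] unfolding E_def by (meson not_le)
  then obtain f where f: "\<And>n. f n \<in> L2 M"
    and big: "\<And>n. 2 * pi * q n * (l2_norm M (f n))\<^sup>2 < E (- 1) 1 (fourier M (f n))"
    by metis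
  \<comment> \<open>A function of norm 0 has zero transform, which contradicts the strict inequality
    in \<open>big\<close>.\<close>
  have nz: "l2_norm M (f n) > 0" for n
  proof (rule ccontr)
    assume "\<not> l2_norm M (f n) > 0"
    then have 0: "l2_norm M (f n) = 0" by (simp add: order_less_le)
    then have "fourier M (f n) z = 0" for z
      using cmod_fourier_le[OF f, of n z] by simp
    then show False using big[of n] 0 by (simp add: E_def)
  qed
  define G where "G n z = fourier M (f n) z / of_real (l2_norm M (f n))" for n z
  have G_hol: "G n holomorphic_on UNIV" for n
    unfolding G_def by (intro holomorphic_intros fourier_holomorphic f) (use nz[of n] in auto)
  have G_le: "cmod (G n z) \<le> exp (R * cmod z) * sqrt (\<zeta> - a)" for n z
    using cmod_fourier_le[OF f, of n z] nz[of n] by (simp add: G_def norm_divide divide_simps)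
  have G_real_le: "cmod (G n (of_real \<xi>)) \<le> sqrt (\<zeta> - a)" for n \<xi>
    using cmod_fourier_real_le[OF f, of n \<xi>] nz[of n] by (simp add: G_def norm_divide divide_simps)
  have cont: "continuous_on S (\<lambda>\<xi>. (cmod (h (complex_of_real \<xi>)))\<^sup>2)" if "h holomorphic_on UNIV" for S h
    by (intro continuous_intros continuous_on_compose2[OF holomorphic_on_imp_continuous_on[OF that]]) auto
  have E_G: "E c d (G n) = E c d (fourier M (f n)) / (l2_norm M (f n))\<^sup>2" for c d n
    unfolding E_def G_def by (simp add: norm_divide power_divide)
  have E1: "2 * pi * q n < E (- 1) 1 (G n)" for n
    using big[of n] nz[of n] by (simp add: E_G field_simps)
  have E2: "E (- 1) 2 (G n) \<le> 2 * pi" for n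
  proof -
    have "E (- 1) 2 (fourier M (f n)) \<le> 2 * pi * (l2_norm M (f n))\<^sup>2"
      using fourier_Plancherel_le[OF f[of n], where c = "- 1" and d = 2] by (simp add: E_def)
    then show ?thesis using nz[of n] by (simp add: E_G divide_simps)
  qed
  \<comment> \<open>Plancherel on \<open>[-1, 2]\<close> allows total mass \<open>2 * pi\<close>,
    nearly all of which already lies on \<open>[-1, 1]\<close>.\<close>
  have E3: "E 1 2 (G n) \<le> 2 * pi * (1 - q n)" for n
  proof -
    have "E (- 1) 1 (G n) + E 1 2 (G n) = E (- 1) 2 (G n)"
      unfolding E_def
      by (rule Henstock_Kurzweil_Integration.integral_combine)
        (auto intro: integrable_continuous_interval cont G_hol)
    then show ?thesis using E1[of n] E2[of n] by (simp add: right_diff_distrib)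
  qed
  define \<H> where "\<H> = {h. h holomorphic_on UNIV \<and> (\<forall>z. cmod (h z) \<le> exp (R * cmod z) * sqrt (\<zeta> - a))}"
  have loc_bdd: "\<exists>B. \<forall>h\<in>\<H>. \<forall>z\<in>C. norm (h z) \<le> B" if "compact C" "C \<subseteq> UNIV" for C
  proof -
    obtain b where b: "\<And>z. z \<in> C \<Longrightarrow> cmod z \<le> b"
      using compact_imp_bounded[OF \<open>compact C\<close>] by (auto simp: bounded_iff)
    have "exp (R * cmod z) * sqrt (\<zeta> - a) \<le> exp (R * b) * sqrt (\<zeta> - a)" if "z \<in> C" for z
      using b[OF that] a_less by (intro mult_right_mono) (auto intro: mult_left_mono)
    then show ?thesis unfolding \<H>_def by (blast intro: order_trans)
  qed
  obtain g r where g: "g holomorphic_on UNIV" and r: "strict_mono (r :: nat \<Rightarrow> nat)"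
    and lim: "\<And>z. (\<lambda>n. G (r n) z) \<longlonglongrightarrow> g z"
    by (rule Montel[of UNIV \<H> G, OF open_UNIV _ loc_bdd])
      (use G_hol G_le in \<open>auto simp: \<H>_def\<close>)
  \<comment> \<open>Pointwise convergence is enough here, since on the real axis the squares are
    dominated by the constant \<open>\<zeta> - a\<close>.\<close>
  have E_lim: "(\<lambda>n. E c d (G (r n))) \<longlonglongrightarrow> E c d g" for c d
    unfolding E_def
  proof (rule dominated_convergence(2))
    show "(\<lambda>\<xi>. (cmod (G (r n) (of_real \<xi>)))\<^sup>2) integrable_on {c..d}" for n
      by (intro integrable_continuous_interval cont G_hol)
    show "(\<lambda>\<xi>::real. \<zeta> - a) integrable_on {c..d}"
      by (intro integrable_continuous_interval continuous_intros)
    show "norm ((cmod (G (r n) (of_real \<xi>)))\<^sup>2) \<le> \<zeta> - a" for n \<xi>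
      using power_mono[OF G_real_le[of "r n" \<xi>], of 2] a_less by simp
    show "(\<lambda>n. (cmod (G (r n) (of_real \<xi>)))\<^sup>2) \<longlonglongrightarrow> (cmod (g (of_real \<xi>)))\<^sup>2" for \<xi>
      by (intro tendsto_intros lim)
  qed
  have q_lim: "(\<lambda>n. q (r n)) \<longlonglongrightarrow> 1"
  proof -
    have "(\<lambda>n. 1 / real (Suc n)) \<longlonglongrightarrow> 0"
      using LIMSEQ_inverse_real_of_nat by (simp add: inverse_eq_divide)
    from tendsto_diff[OF tendsto_const[of 1] this] have "q \<longlonglongrightarrow> 1" by (simp add: q_def[abs_def])
    then show ?thesis using LIMSEQ_subseq_LIMSEQ[OF _ r] by (auto simp: o_def)
  qed
  have "(\<lambda>n. 2 * pi * (1 - q (r n))) \<longlonglongrightarrow> 2 * pi * (1 - 1)"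
    by (intro tendsto_intros q_lim)
  then have "E 1 2 g \<le> 0"
    using LIMSEQ_le[OF E_lim[of 1 2], of "\<lambda>n. 2 * pi * (1 - q (r n))" 0] E3 by auto
  moreover have "E 1 2 g \<ge> 0"
    unfolding E_def by (intro integral_nonneg integrable_continuous_interval cont g) simp
  ultimately have "E 1 2 g = 0" by simp
  then have zero: "g (of_real \<xi>) = 0" if "\<xi> \<in> {1..2}" for \<xi>
    using that unfolding E_def by (subst (asm) integral_eq_0_iff) (auto intro: cont g)
  \<comment> \<open>The identity theorem needs a limit point of the zero set; the endpoint 1
    serves.\<close>
  have "(1::real) islimpt {1..2}" by simp
  then have "complex_of_real 1 islimpt complex_of_real ` {1..2}"
    by (rule islimpt_isCont_image) (auto simp: eventually_at_filter)
  then have "g z = 0" for z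
    by (rule analytic_continuation[OF g open_UNIV connected_UNIV subset_UNIV UNIV_I])
      (use zero in auto)
  then have "E (- 1) 1 g = 0" by (simp add: E_def)
  moreover have "2 * pi * 1 \<le> E (- 1) 1 g"
  proof (rule LIMSEQ_le[OF _ E_lim])
    show "(\<lambda>n. 2 * pi * q (r n)) \<longlonglongrightarrow> 2 * pi * 1"
      by (intro tendsto_intros q_lim)
  qed (use E1 less_imp_le in blast)
  ultimately show False using pi_gt_zero by simp
qed

text \<open>A concentration constant depending on the interval only, fixed once so that later
  constants can be built from it.\<close>

definition sine_bound :: real where
  "sine_bound = (SOME q. 0 \<le> q \<and> q < 1 \<and>
    (\<forall>f\<in>L2 M. integral {- 1..1} (\<lambda>\<xi>. (cmod (F f \<xi>))\<^sup>2) \<le> 2 * pi * q * (l2_norm M f)\<^sup>2))"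

lemma sine_bound:
  shows sine_bound_nonneg: "0 \<le> sine_bound" and sine_bound_less: "sine_bound < 1"
    and "\<And>f. f \<in> L2 M \<Longrightarrow>
      integral {- 1..1} (\<lambda>\<xi>. (cmod (F f \<xi>))\<^sup>2) \<le> 2 * pi * sine_bound * (l2_norm M f)\<^sup>2"
  using someI_ex[OF fourier_concentration_lt] unfolding sine_bound_def by auto

lemma sine_op_inner_le:
  assumes f: "f \<in> L2 M" and g: "g \<in> L2 M"
  shows "cmod (l2_inner M (K f) g) \<le> sine_bound * l2_norm M f * l2_norm M g"
proof -
  have le: "l2_norm freq_measure (F h) \<le> sqrt (2 * pi * sine_bound) * l2_norm M h" if "h \<in> L2 M" for h
    by (rule power2_le_imp_le)
      (use sine_bound(3)[OF that] sine_bound_nonneg in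
        \<open>simp_all add: fourier_freq_norm[OF that] power_mult_distrib\<close>)
  have "cmod (l2_inner M (K f) g) = cmod (l2_inner freq_measure (F f) (F g)) / (2 * pi)"
    by (simp add: sine_op_inner[OF f g] norm_divide norm_mult)
  also have "\<dots> \<le> (l2_norm freq_measure (F f) * l2_norm freq_measure (F g)) / (2 * pi)"
    by (intro divide_right_mono L2_Cauchy_Schwarz fourier_freq_L2 f g) simp
  also have "\<dots> \<le> (sqrt (2 * pi * sine_bound) * l2_norm M f * (sqrt (2 * pi * sine_bound) * l2_norm M g)) / (2 * pi)"
    by (intro divide_right_mono mult_mono le f g) (use sine_bound_nonneg in auto)
  also have "\<dots> = sine_bound * l2_norm M f * l2_norm M g"
    using sine_bound_nonneg by (simp add: field_simps flip: real_sqrt_mult)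
  finally show ?thesis .
qed

text \<open>Tests the bilinear bound against \<open>K f\<close> itself and cancels one factor of its
  norm.\<close>

lemma sine_op_norm_le:
  assumes f: "f \<in> L2 M"
  shows "l2_norm M (K f) \<le> sine_bound * l2_norm M f"
proof (cases "l2_norm M (K f) = 0")
  case True
  then show ?thesis using sine_bound_nonneg by simp
next
  case False
  have Kf: "K f \<in> L2 M" by (rule kernel_op_L2[OF sine_kernel_bounded f])
  have "l2_norm M (K f) * l2_norm M (K f) \<le> sine_bound * l2_norm M f * l2_norm M (K f)"
    using sine_op_inner_le[OF f Kf] by (simp add: l2_inner_self norm_power power2_eq_square norm_mult)
  then show ?thesis using False by (simp add: order_less_le)
qed

lemma sine_op_inner_self:
  assumes "f \<in> L2 M"
  shows "l2_inner M (K f) f = of_real ((l2_norm freq_measure (F f))\<^sup>2 / (2 * pi))"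
  by (simp add: sine_op_inner[OF assms assms] l2_inner_self)

end

section \<open>Triangular factorization\<close>

definition lower :: "(real \<Rightarrow> real \<Rightarrow> real) \<Rightarrow> real \<Rightarrow> real \<Rightarrow> real" where
  "lower h = (\<lambda>x t. if t \<le> x then h x t else 0)"

lemma bounded_kernel_lower:
  assumes h: "bounded_kernel h" shows "bounded_kernel (lower h)"
proof -
  obtain C where C: "0 \<le> C" "\<And>x t. \<bar>h x t\<bar> \<le> C" using bounded_kernel_bound[OF h] by blast
  show ?thesis
  proof (rule bounded_kernelI)
    show "(\<lambda>(x, t). lower h x t) \<in> borel_measurable (borel \<Otimes>\<^sub>M borel)"
      unfolding lower_def using bounded_kernel_borel[OF h, measurable] by measurable
    show "\<bar>lower h x t\<bar> \<le> C" for x t using C by (simp add: lower_def)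
  qed
qed

lemma kernel_op_scale: "kernel_op M (\<lambda>x t. c * h x t) f x = of_real c * kernel_op M h f x"
  by (simp add: kernel_op_def mult.assoc)

lemma kernel_op_cong: "(\<And>t. t \<in> space M \<Longrightarrow> f t = g t) \<Longrightarrow> kernel_op M h f x = kernel_op M h g x"
  unfolding kernel_op_def by (intro Bochner_Integration.integral_cong) auto

lemma id_plus_cong:
  "(\<And>t. t \<in> space M \<Longrightarrow> f t = g t) \<Longrightarrow> x \<in> space M \<Longrightarrow> id_plus M h f x = id_plus M h g x"
  unfolding id_plus_def using kernel_op_cong by metis

lemma S_op_eq_id_plus:
  "S_op \<gamma> a \<zeta> = id_plus (interval_measure_on a \<zeta>) (\<lambda>x t. - \<gamma> * sine_kernel x t)"
  unfolding S_op_def id_plus_def kernel_op_scale by (intro ext) (simp add: kernel_op_def)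

lemma minus_S_op_eq_kernel_op:
  "(\<lambda>f x. f x - S_op \<gamma> a \<zeta> f x) = kernel_op (interval_measure_on a \<zeta>) (\<lambda>x t. \<gamma> * sine_kernel x t)"
  unfolding S_op_eq_id_plus id_plus_def kernel_op_scale by (intro ext) simp

section \<open>Null diagonals and injectivity of Volterra operators\<close>

context bounded_interval
begin

lemma AE_neq: "AE t in M. t \<noteq> x"
  unfolding interval_measure_on_def
  by (subst AE_restrict_space_iff) (auto intro: AE_mp[OF AE_lborel_singleton])

lemma kernel_op_zero_off_diagonal:
  assumes "\<And>t. t \<noteq> x \<Longrightarrow> h x t = 0" shows "kernel_op M h f x = 0"
  unfolding kernel_op_def
  by (rule integral_eq_zero_AE) (use AE_neq[of x] assms in \<open>auto elim: AE_mp\<close>)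

text \<open>For each \<open>x\<close> the diagonal meets the line of integration in one point, a
  null set. The triangular kernels below thus need to match only off the diagonal.\<close>

lemma id_plus_zero_off_diagonal:
  assumes "\<And>x t. t \<noteq> x \<Longrightarrow> h x t = 0" shows "id_plus M h f x = f x"
  using kernel_op_zero_off_diagonal[of x h f] assms by (simp add: id_plus_def)

text \<open>Each integration gains a factor \<open>1 / (n + 1)\<close>; in
  \<open>Volterra_injective\<close> these accumulate to the factorial.\<close>

lemma integral_power_upto:
  assumes x: "x \<in> space M"
  shows "(LINT t|M. (if t < x then (t - a) ^ n else 0)) = (x - a) ^ Suc n / real (Suc n)"
    and "integrable M (\<lambda>t. if t < x then (t - a) ^ n else 0)"
proof -
  have ax: "a < x" "x < \<zeta>" using x by (auto simp: space_M)
  have ind: "indicator {a<..<\<zeta>} t *\<^sub>R (if t < x then (t - a) ^ n else 0)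
      = indicator {a<..<x} t *\<^sub>R (t - a) ^ n" for t
    using ax by (auto simp: indicator_def)
  have cont: "continuous_on {a..x} (\<lambda>t. (t - a) ^ n)" by (intro continuous_intros)
  have "(LINT t|M. (if t < x then (t - a) ^ n else 0)) = (LINT t|interval_measure_on a x. (t - a) ^ n)"
    unfolding interval_measure_on_def 
    by (simp add: integral_restrict_space ind del: real_scaleR_def)
  also have "\<dots> = integral {a..x} (\<lambda>t. (t - a) ^ n)"
    by (rule lint_interval_measure(1)[OF cont])
  also have "\<dots> = (x - a) ^ Suc n / real (Suc n)"
  proof -
    have "((\<lambda>t. (t - a) ^ Suc n / real (Suc n)) has_vector_derivative (t - a) ^ n) (at t within {a..x})" for t
      unfolding has_real_derivative_iff_has_vector_derivative [symmetric]
      by (auto intro!: derivative_eq_intros simp del: of_nat_Suc power_Suc)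
    then have "((\<lambda>t. (t - a) ^ n) has_integral (x - a) ^ Suc n / real (Suc n) - (a - a) ^ Suc n / real (Suc n)) {a..x}"
      using ax by (intro fundamental_theorem_of_calculus) auto
    then show ?thesis by (simp add: integral_unique)
  qed
  finally show "(LINT t|M. (if t < x then (t - a) ^ n else 0)) = (x - a) ^ Suc n / real (Suc n)" .
  show "integrable M (\<lambda>t. if t < x then (t - a) ^ n else 0)"
    using lint_interval_measure(2)[OF cont]
    unfolding interval_measure_on_def
    by (simp add: integrable_restrict_space ind del: real_scaleR_def)
qed

text \<open>The equation says that \<open>f\<close> is minus its own Volterra integral. Feeding a
  bound for \<open>f\<close> back into it \<open>n\<close> times gives
  \<open>D * (C * (x - a)) ^ n / fact n\<close>, which tends to 0.\<close>

lemma Volterra_injective: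
  assumes h: "bounded_kernel h" and tri: "\<And>x t. \<not> t < x \<Longrightarrow> h x t = 0"
    and f: "f \<in> L2 M" and zero: "\<And>x. x \<in> space M \<Longrightarrow> id_plus M h f x = 0" and x: "x \<in> space M"
  shows "f x = 0"
proof -
  obtain C where C: "0 \<le> C" "\<And>x t. \<bar>h x t\<bar> \<le> C" using bounded_kernel_bound[OF h] by blast
  define D where "D = C * sqrt (measure M (space M)) * l2_norm M f"
  have eq: "cmod (f x) = cmod (kernel_op M h f x)" if "x \<in> space M" for x
    using zero[OF that] by (simp add: id_plus_def add_eq_0_iff2)
  have bound: "cmod (f x) \<le> D * (C * (x - a)) ^ n / fact n" if "x \<in> space M" for n x
    using that
  proof (induction n arbitrary: x)
    case 0
    then show ?case using eq kernel_op_bound[OF C(2,1) f] by (simp add: D_def)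
  next
    case (Suc n)
    define c where "c = C * (D * C ^ n / fact n)"
    have "cmod (f x) \<le> (LINT t|M. cmod (of_real (h x t) * f t))"
      unfolding eq[OF Suc.prems] kernel_op_def by (rule integral_norm_bound)
    also have "\<dots> \<le> (LINT t|M. c * (if t < x then (t - a) ^ n else 0))"
    proof (rule integral_mono)
      show "integrable M (\<lambda>t. cmod (of_real (h x t) * f t))"
        by (intro integrable_norm kernel_op_integrable h L2_integrable f)
      show "integrable M (\<lambda>t. c * (if t < x then (t - a) ^ n else 0))"
        by (intro integrable_mult_right integral_power_upto Suc.prems)
      show "cmod (of_real (h x t) * f t) \<le> c * (if t < x then (t - a) ^ n else 0)"
        if t: "t \<in> space M" for t
      proof (cases "t < x")
        case True
        have "\<bar>h x t\<bar> * cmod (f t) \<le> C * (D * (C * (t - a)) ^ n / fact n)"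
          by (intro mult_mono C Suc.IH t) auto
        then show ?thesis using True by (simp add: c_def norm_mult power_mult_distrib mult_ac)
      qed (simp add: tri)
    qed
    also have "\<dots> = c * ((x - a) ^ Suc n / real (Suc n))"
      by (simp only: integral_mult_right_zero integral_power_upto[OF Suc.prems])
    also have "\<dots> = D * (C * (x - a)) ^ Suc n / fact (Suc n)"
    proof -
      have "C * (D * C ^ n / fact n) * (y ^ Suc n / real (Suc n)) = D * (C * y) ^ Suc n / fact (Suc n)" for y
        by (simp add: power_mult_distrib field_simps)
      then show ?thesis unfolding c_def .
    qed
    finally show ?case .
  qed
  have "(\<lambda>n. D * ((C * (x - a)) ^ n / fact n)) \<longlonglongrightarrow> D * 0"
    using summable_LIMSEQ_zero[OF summable_exp[of "C * (x - a)"]]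
    by (intro tendsto_intros) (simp add: divide_inverse mult.commute)
  then have "cmod (f x) \<le> D * 0"
    by (rule LIMSEQ_le_const) (use bound[OF x] in auto)
  then show ?thesis by simp
qed

end

section \<open>Neumann series for the truncated integral equations\<close>

locale sine_interval = bounded_interval +
  fixes \<gamma> :: real
  assumes \<gamma>: "0 < \<gamma>" "\<gamma> \<le> 1"
begin

definition k :: "real \<Rightarrow> real \<Rightarrow> real" where "k x t = \<gamma> * sine_kernel x t"

lemma k_bounded: "bounded_kernel k"
  unfolding k_def by (rule bounded_kernel_sine)

lemma k_sym: "k x t = k t x"
  by (simp add: k_def sine_kernel_sym)

lemma abs_k_le: "\<bar>k x t\<bar> \<le> 1 / pi"
proof -
  have "\<gamma> * \<bar>sine_kernel x t\<bar> \<le> 1 * (1 / pi)"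
    using \<gamma> by (intro mult_mono abs_sine_kernel_le) auto
  then show ?thesis using \<gamma> by (simp add: k_def abs_mult)
qed

lemma kernel_op_k: "kernel_op M k f x = of_real \<gamma> * K f x"
  unfolding k_def by (rule kernel_op_scale)

text \<open>The maximum with \<open>1 / 2\<close> keeps the contraction ratio positive, as
  \<open>B\<close> divides by it.\<close>

definition q :: real where "q = max sine_bound (1 / 2)"

lemma q: "0 < q" "q < 1"
  using sine_bound_less by (auto simp: q_def)

lemma kernel_op_k_norm_le:
  assumes f: "f \<in> L2 M" shows "l2_norm M (kernel_op M k f) \<le> q * l2_norm M f"
proof -
  have "l2_norm M (kernel_op M k f) = \<gamma> * l2_norm M (K f)"
    unfolding kernel_op_k[abs_def] l2_norm_cmult using \<gamma> by simp
  also have "\<dots> \<le> 1 * (q * l2_norm M f)"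
  proof (rule mult_mono)
    have "sine_bound * l2_norm M f \<le> q * l2_norm M f"
      by (intro mult_right_mono) (auto simp: q_def)
    then show "l2_norm M (K f) \<le> q * l2_norm M f"
      by (rule order_trans[OF sine_op_norm_le[OF f]])
  qed (use \<gamma> in auto)
  finally show ?thesis by simp
qed

text \<open>
  The kernels \<open>w n (\<cdot>, t)\<close> are the Neumann iterates of \<open>k (\<cdot>, t)\<close> for the compression of
  the operator to \<open>[t, \<zeta>]\<close>.
\<close>

primrec w :: "nat \<Rightarrow> real \<Rightarrow> real \<Rightarrow> real" where
  "w 0 = k"
| "w (Suc n) = kernel_comp M k (lower (w n))"

lemma w_bounded_kernel: "bounded_kernel (w n)"
  by (induction n) (auto intro: k_bounded bounded_kernel_comp bounded_kernel_lower)

definition section_fn where "section_fn n t = (\<lambda>s. complex_of_real (lower (w n) s t))"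

lemma section_fn_L2: "section_fn n t \<in> L2 M"
proof -
  have b: "bounded_kernel (lower (w n))"
    by (intro bounded_kernel_lower w_bounded_kernel)
  obtain C where C: "0 \<le> C" "\<And>x t. \<bar>lower (w n) x t\<bar> \<le> C" using bounded_kernel_bound[OF b] by blast
  show ?thesis
    unfolding section_fn_def
    by (rule L2_bounded(1)[of _ C])
      (use C borel_measurable_integrable[OF kernel_section_integrable[OF b]] in auto)
qed

lemma w_Suc: "of_real (w (Suc n) x t) = kernel_op M k (section_fn n t) x"
  by (simp add: section_fn_def kernel_op_of_real)

text \<open>Truncation to \<open>[t, \<zeta>]\<close> does not increase the norm, so every iteration
  costs a factor \<open>q\<close>, uniformly in \<open>t\<close>.\<close>

lemma section_fn_norm_le: "l2_norm M (section_fn n t) \<le> sqrt (\<zeta> - a) * q ^ n"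
proof (induction n)
  case 0
  have "l2_norm M (section_fn 0 t) \<le> \<bar>1 / pi\<bar> * sqrt (measure M (space M))"
    by (rule L2_bounded(2)[OF L2_measurable[OF section_fn_L2]])
      (use abs_k_le in \<open>auto simp: section_fn_def lower_def\<close>)
  also have "\<dots> \<le> 1 * sqrt (\<zeta> - a)"
    unfolding measure_M using pi_gt3 a_less by (intro mult_right_mono) auto
  finally show ?case by simp
next
  case (Suc n)
  have "cmod (section_fn (Suc n) t x) \<le> cmod (kernel_op M k (section_fn n t) x)" for x
    unfolding w_Suc[symmetric] by (simp add: section_fn_def lower_def)
  then have "l2_norm M (section_fn (Suc n) t) \<le> l2_norm M (kernel_op M k (section_fn n t))"
    by (intro l2_norm_bound(2) L2_measurable section_fn_L2 kernel_op_L2 k_bounded)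
  also have "\<dots> \<le> q * l2_norm M (section_fn n t)"
    by (rule kernel_op_k_norm_le[OF section_fn_L2])
  also have "\<dots> \<le> q * (sqrt (\<zeta> - a) * q ^ n)"
    using q by (intro mult_left_mono Suc.IH) simp
  finally show ?case by (simp add: mult_ac)
qed

text \<open>The summand 1 covers \<open>w 0\<close>, as \<open>1 / pi \<le> 1\<close>. The other
  covers later iterates, where dividing by \<open>q\<close> restores the power lost in passing from
  \<open>section_fn m t\<close> to \<open>w (Suc m)\<close>.\<close>

definition B :: real where "B = 1 + (\<zeta> - a) / q"

lemma B_nonneg: "0 \<le> B"
  using a_less q by (simp add: B_def)

text \<open>Geometric decay in norm becomes uniform decay, because one application of the bounded
  kernel \<open>k\<close> turns a norm bound into a pointwise bound.\<close>

lemma abs_w_le: "\<bar>w n x t\<bar> \<le> B * q ^ n"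
proof (cases n)
  case 0
  have "1 / pi \<le> 1" using pi_gt3 by simp
  moreover have "0 \<le> (\<zeta> - a) / q" using a_less q by simp
  ultimately have "\<bar>k x t\<bar> \<le> B" using abs_k_le[of x t] unfolding B_def by linarith
  then show ?thesis by (simp add: 0)
next
  case (Suc m)
  have "\<bar>w (Suc m) x t\<bar> = cmod (kernel_op M k (section_fn m t) x)"
    unfolding w_Suc[symmetric] by (simp del: w.simps)
  also have "\<dots> \<le> 1 / pi * sqrt (\<zeta> - a) * l2_norm M (section_fn m t)"
    unfolding measure_M[symmetric] by (intro kernel_op_bound abs_k_le section_fn_L2) simp
  also have "\<dots> \<le> 1 * sqrt (\<zeta> - a) * (sqrt (\<zeta> - a) * q ^ m)"
    using a_less pi_gt3 by (intro mult_mono section_fn_norm_le) auto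
  also have "\<dots> = (\<zeta> - a) / q * q ^ Suc m"
    using a_less q by (simp flip: mult.assoc)
  also have "\<dots> \<le> B * q ^ Suc m"
    using q by (intro mult_right_mono) (auto simp: B_def)
  finally show ?thesis using Suc by (simp del: w.simps)
qed

lemma summable_bound: "summable (\<lambda>n. c * (B * q ^ n))"
  using q by (intro summable_mult summable_geometric) simp

lemma summable_w: "summable (\<lambda>n. \<bar>w n x t\<bar>)"
  by (rule summable_comparison_test'[OF summable_bound[of 1]]) (use abs_w_le in simp)

definition W :: "real \<Rightarrow> real \<Rightarrow> real" where "W x t = (\<Sum>n. w n x t)"

lemma W_bounded_kernel: "bounded_kernel W"
proof (rule bounded_kernelI)
  have "(\<lambda>p. \<Sum>n. w n (fst p) (snd p)) \<in> borel_measurable (borel \<Otimes>\<^sub>M borel)"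
    using bounded_kernel_borel[OF w_bounded_kernel] unfolding split_beta'
    by (intro borel_measurable_suminf)
  then show "(\<lambda>(x, t). W x t) \<in> borel_measurable (borel \<Otimes>\<^sub>M borel)"
    by (simp add: W_def split_beta')
  fix x t
  have "\<bar>W x t\<bar> \<le> (\<Sum>n. \<bar>w n x t\<bar>)"
    unfolding W_def by (rule summable_rabs[OF summable_w])
  also have "\<dots> \<le> (\<Sum>n. 1 * (B * q ^ n))"
    by (intro suminf_le summable_w summable_bound) (use abs_w_le in simp)
  finally show "\<bar>W x t\<bar> \<le> (\<Sum>n. 1 * (B * q ^ n))" .
qed

text \<open>Integrating the series term by term shifts its index by one. The equation holds on both
  sides of the diagonal: for \<open>t \<le> x\<close> it is the integral equation for
  \<open>V\<close>, and for \<open>x < t\<close> it evaluates the remainder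
  \<open>U\<close>.\<close>

lemma W_eq: "W x t = k x t + kernel_comp M k (lower W) x t"
proof -
  define u where "u n s = k x s * lower (w n) s t" for n s
  have int: "integrable M (u n)" for n
    unfolding u_def by (intro kernel_comp_integrable k_bounded bounded_kernel_lower w_bounded_kernel)
  have le: "norm (u n s) \<le> 1 / pi * (B * q ^ n)" for n s
    unfolding u_def real_norm_def abs_mult
    using abs_w_le[of n s t] B_nonneg q
    by (intro mult_mono abs_k_le) (auto simp: lower_def)
  have s2: "summable (\<lambda>n. LINT s|M. norm (u n s))"
  proof (rule summable_comparison_test'[OF summable_bound])
    fix n :: nat assume "0 \<le> n"
    have "(LINT s|M. norm (u n s)) \<le> (LINT s|M. 1 / pi * (B * q ^ n))"
      by (rule integral_mono) (use int le in auto)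
    then show "norm (LINT s|M. norm (u n s)) \<le> (\<zeta> - a) / pi * (B * q ^ n)"
      by (simp add: measure_M)
  qed
  have s1: "summable (\<lambda>n. norm (u n s))" for s
    by (rule summable_comparison_test'[OF summable_bound[of "1 / pi"]])
      (use le in \<open>simp only: real_norm_def abs_abs\<close>)
  have lowerW: "k x s * lower W s t = (\<Sum>n. u n s)" for s
    using summable_rabs_cancel[OF summable_w] by (auto simp: u_def lower_def W_def suminf_mult)
  have "kernel_comp M k (lower W) x t = (\<Sum>n. integral\<^sup>L M (u n))"
    unfolding kernel_comp_def lowerW by (rule integral_suminf[OF int _ s2]) (use s1 in simp)
  also have "\<dots> = (\<Sum>n. w (Suc n) x t)"
    by (simp add: u_def[abs_def] kernel_comp_def)
  also have "\<dots> = W x t - w 0 x t"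
    unfolding W_def by (rule suminf_split_head[OF summable_rabs_cancel[OF summable_w]])
  finally show ?thesis by simp
qed

section \<open>The triangular kernels and their inverses\<close>

definition V where "V = lower W"

text \<open>The remainder of the kernel of \<open>S (I + V)\<close> after subtracting the identity.
  The diagonal went to \<open>V\<close>, so the inequality is strict here; with this split
  \<open>U_eq\<close> holds at every point.\<close>

definition U where "U x t = (if x < t then - W x t else 0)"

abbreviation VT where "VT \<equiv> \<lambda>x t. V t x"

text \<open>\<open>id_plus M L\<close> becomes the lower triangular factor of \<open>S\<close>; its
  adjoint is \<open>id_plus M U\<close> and its inverse \<open>id_plus M V\<close>.\<close>

abbreviation L where "L \<equiv> \<lambda>x t. U t x"

text \<open>This is \<open>- k\<close>, written out so that \<open>id_plus M N\<close> matches
  \<open>S_op_eq_id_plus\<close> literally.\<close>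

definition N where "N x t = - \<gamma> * sine_kernel x t"

lemma N_bounded: "bounded_kernel N"
  unfolding N_def by (rule bounded_kernel_sine)

lemma N_sym: "N x t = N t x"
  by (simp add: N_def sine_kernel_sym)

lemma V_bounded: "bounded_kernel V"
  unfolding V_def by (intro bounded_kernel_lower W_bounded_kernel)

lemma U_eq: "U x t = N x t + V x t + kernel_comp M N V x t"
proof -
  have "kernel_comp M N V x t = - kernel_comp M k V x t"
    by (simp add: kernel_comp_def k_def N_def mult.assoc)
  then show ?thesis
    using W_eq[of x t] by (auto simp: U_def V_def lower_def k_def N_def)
qed

lemma U_bounded: "bounded_kernel U"
  unfolding U_eq[abs_def] by (intro bounded_kernel_add bounded_kernel_comp N_bounded V_bounded)

lemmas VT_bounded = bounded_kernel_transpose[OF V_bounded]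
lemmas L_bounded = bounded_kernel_transpose[OF U_bounded]

lemma S_V: "f \<in> L2 M \<Longrightarrow> id_plus M N (id_plus M V f) x = id_plus M U f x"
  by (simp only: id_plus_id_plus[OF N_bounded V_bounded] flip: U_eq)

text \<open>
  \<open>X\<close> is the kernel of \<open>(I + V)\<^sup>* (I - k) (I + V) - I\<close>, hence symmetric; as a product of two upper
  triangular factors it is also upper triangular, so it lives on the diagonal.
\<close>

definition X where "X x t = V t x + U x t + kernel_comp M VT U x t"

text \<open>After inserting \<open>U_eq\<close> for \<open>U\<close>, each term is symmetric or
  occurs together with its transpose. Associativity is what makes the triple product of
  \<open>VT\<close>, \<open>N\<close> and \<open>V\<close> symmetric.\<close>

lemma X_sym: "X x t = X t x"
proof -
  have tr: "kernel_comp M VT N x t = kernel_comp M N V t x" for x t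
  proof -
    have "(\<lambda>x t. N t x) = N" by (intro ext) (rule N_sym)
    then show ?thesis using kernel_comp_transpose[of V N x t] by simp
  qed
  have "kernel_comp M VT U x t
      = kernel_comp M VT N x t + kernel_comp M VT V x t + kernel_comp M VT (kernel_comp M N V) x t" for x t
    unfolding U_eq[abs_def]
    by (simp only: kernel_comp_add_right bounded_kernel_add bounded_kernel_comp N_bounded V_bounded VT_bounded)
  then have X: "X x t = V t x + V x t + N x t + kernel_comp M N V x t + kernel_comp M N V t x
      + kernel_comp M VT V x t + kernel_comp M VT (kernel_comp M N V) x t" for x t
    unfolding X_def U_eq[of x t] tr by simp
  have "kernel_comp M VT V t x = kernel_comp M VT V x t"
    by (simp add: kernel_comp_def mult.commute)
  moreover have "kernel_comp M VT (kernel_comp M N V) t x = kernel_comp M VT (kernel_comp M N V) x t"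
  proof -
    have "kernel_comp M VT (kernel_comp M N V) t x = kernel_comp M (\<lambda>x t. kernel_comp M N V t x) V x t"
      using kernel_comp_transpose[of V "\<lambda>x t. kernel_comp M N V t x" t x] by simp
    also have "\<dots> = kernel_comp M (kernel_comp M VT N) V x t"
      unfolding tr[symmetric] ..
    also have "\<dots> = kernel_comp M VT (kernel_comp M N V) x t"
      by (rule kernel_comp_assoc[OF VT_bounded N_bounded V_bounded, symmetric])
    finally show ?thesis .
  qed
  ultimately show ?thesis
    unfolding X using N_sym[of x t] by simp
qed

text \<open>For \<open>t < x\<close> a nonzero term of the product would need
  \<open>x \<le> s\<close> and \<open>s < t\<close>, which is impossible; symmetry then gives the
  other side.\<close>

lemma X_zero: "x \<noteq> t \<Longrightarrow> X x t = 0"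
proof -
  have "X x t = 0" if "t < x" for x t
  proof -
    have "V s x * U s t = 0" for s
      using that by (auto simp: V_def lower_def U_def)
    then have "kernel_comp M VT U x t = 0"
      by (simp only: kernel_comp_def Bochner_Integration.integral_zero)
    then show ?thesis using that by (simp add: X_def V_def lower_def U_def)
  qed
  then show "x \<noteq> t \<Longrightarrow> X x t = 0" using X_sym by (metis linorder_neqE)
qed

text \<open>\<open>X\<close> may be nonzero on the diagonal, but there it does not affect the
  integral operator, so the product is the identity at every point.\<close>

lemma VT_U: "f \<in> L2 M \<Longrightarrow> id_plus M VT (id_plus M U f) x = f x"
  by (simp only: id_plus_id_plus[OF VT_bounded U_bounded] flip: X_def)
    (intro id_plus_zero_off_diagonal X_zero, simp)

lemma L_V: "f \<in> L2 M \<Longrightarrow> id_plus M L (id_plus M V f) x = f x"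
proof -
  have "U t x + V x t + kernel_comp M L V x t = X t x" for x t
    by (simp add: X_def kernel_comp_def mult.commute)
  then show "f \<in> L2 M \<Longrightarrow> id_plus M L (id_plus M V f) x = f x"
    by (simp only: id_plus_id_plus[OF L_bounded V_bounded])
      (intro id_plus_zero_off_diagonal X_zero, simp)
qed

text \<open>\<open>L_V\<close> makes \<open>id_plus M V\<close> only a right inverse of
  \<open>id_plus M L\<close>. For the other order, the defect \<open>g\<close> is annihilated by
  \<open>id_plus M L\<close>, hence is 0 since \<open>L\<close> is strictly lower
  triangular.\<close>

lemma V_L:
  assumes f: "f \<in> L2 M" and x: "x \<in> space M"
  shows "id_plus M V (id_plus M L f) x = f x"
proof -
  note L2 = id_plus_L2[OF V_bounded id_plus_L2[OF L_bounded f]]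
  define g where "g = (\<lambda>y. id_plus M V (id_plus M L f) y + - 1 * f y)"
  have g: "g \<in> L2 M" unfolding g_def by (intro L2_add L2_cmult f L2)
  have "id_plus M L g y = 0" for y
  proof -
    have "kernel_op M L g y = kernel_op M L (id_plus M V (id_plus M L f)) y + - 1 * kernel_op M L f y"
      unfolding g_def
      by (simp only: kernel_op_add[OF L_bounded L2_integrable[OF L2] L2_integrable[OF L2_cmult[OF f]]]
          kernel_op_cmult)
    then have "id_plus M L g y = id_plus M L (id_plus M V (id_plus M L f)) y - id_plus M L f y"
      by (simp add: id_plus_def[of M L] g_def)
    then show ?thesis
      using L_V[OF id_plus_L2[OF L_bounded f], of y] by simp
  qed
  then have "g x = 0"
    by (intro Volterra_injective[OF L_bounded _ g _ x]) (auto simp: U_def)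
  then show ?thesis by (simp add: g_def)
qed

text \<open>The adjoint of \<open>V_L\<close>: the defect \<open>h\<close> turns out to be
  orthogonal to itself. This duality argument yields equality almost everywhere only.\<close>

lemma U_VT:
  assumes f: "f \<in> L2 M" shows "AE x in M. id_plus M U (id_plus M VT f) x = f x"
proof -
  define h where "h = (\<lambda>x. id_plus M U (id_plus M VT f) x - f x)"
  have L2: "id_plus M U (id_plus M VT f) \<in> L2 M"
    by (intro id_plus_L2 U_bounded VT_bounded f)
  then have h: "h \<in> L2 M" unfolding h_def by (intro L2_diff f)
  have adj: "l2_inner M (id_plus M j u) v = l2_inner M u (id_plus M (\<lambda>x t. j t x) v)"
    if "bounded_kernel j" "u \<in> L2 M" "v \<in> L2 M" for j u v
    using adjoint_ops_id_plus[OF that(1)] that(2,3) unfolding adjoint_ops_def by blast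
  have "l2_inner M (id_plus M U (id_plus M VT f)) h = l2_inner M (id_plus M VT f) (id_plus M L h)"
    by (intro adj U_bounded id_plus_L2 VT_bounded f h)
  also have "\<dots> = l2_inner M f (id_plus M V (id_plus M L h))"
    by (intro adj VT_bounded id_plus_L2 L_bounded f h)
  also have "\<dots> = l2_inner M f h"
    unfolding l2_inner_def by (intro Bochner_Integration.integral_cong) (auto simp: V_L[OF h])
  finally have "l2_inner M h h = 0"
    unfolding h_def by (subst l2_inner_diff_left) (use L2 f h in \<open>simp_all add: h_def\<close>)
  then have "l2_norm M h = 0" by (simp add: l2_inner_self)
  from l2_norm_zero_imp_AE[OF h this] show ?thesis by (simp add: h_def)
qed

text \<open>Insert the identity in the form of \<open>V_L\<close> and absorb
  \<open>id_plus M V\<close> into the left factor by \<open>S_V\<close>.\<close>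

lemma S_eq_U_L:
  assumes f: "f \<in> L2 M" and x: "x \<in> space M"
  shows "id_plus M N f x = id_plus M U (id_plus M L f) x"
proof -
  have "id_plus M N f x = id_plus M N (id_plus M V (id_plus M L f)) x"
    by (rule id_plus_cong[OF _ x]) (simp add: V_L f)
  then show ?thesis by (simp add: S_V id_plus_L2 L_bounded f)
qed

section \<open>Invertibility, factorization, positivity and trace class\<close>

lemma invertible_S: "invertible_op M (id_plus M N)"
proof -
  \<comment> \<open>\<open>I + J = (I + V)(I + VT)\<close>, the product of the inverses of
    \<open>I + L\<close> and \<open>I + U\<close> in reverse order.\<close>
  define J where "J x t = V x t + V t x + kernel_comp M V VT x t" for x t
  have J: "bounded_kernel J"
    unfolding J_def by (intro bounded_kernel_add bounded_kernel_comp V_bounded VT_bounded)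
  have J_eq: "id_plus M J f x = id_plus M V (id_plus M VT f) x" if "f \<in> L2 M" for f x
    unfolding J_def[abs_def] by (rule id_plus_id_plus[OF V_bounded VT_bounded that, symmetric])
  have "AE x in M. id_plus M N (id_plus M J f) x = f x" if f: "f \<in> L2 M" for f
    using U_VT[OF f] by (simp add: J_eq[OF f, abs_def] S_V id_plus_L2 VT_bounded f)
  moreover have "id_plus M J (id_plus M N f) x = f x" if f: "f \<in> L2 M" and x: "x \<in> space M" for f x
  proof -
    have "id_plus M VT (id_plus M N f) y = id_plus M L f y" if y: "y \<in> space M" for y
    proof -
      have "id_plus M VT (id_plus M N f) y = id_plus M VT (id_plus M U (id_plus M L f)) y"
        by (rule id_plus_cong[OF S_eq_U_L[OF f] y])
      then show ?thesis by (simp add: VT_U id_plus_L2 L_bounded f)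
    qed
    then have "id_plus M V (id_plus M VT (id_plus M N f)) x = id_plus M V (id_plus M L f) x"
      by (rule id_plus_cong[OF _ x])
    then show ?thesis by (simp add: J_eq id_plus_L2[OF N_bounded f] V_L[OF f x])
  qed
  ultimately have "inverse_ops M (id_plus M N) (id_plus M J)"
    unfolding inverse_ops_def op_eq_def using bounded_op_id_plus[OF N_bounded] bounded_op_id_plus[OF J] by auto
  then show ?thesis unfolding invertible_op_def by blast
qed

lemma factorable_S: "factorable a \<zeta> (id_plus M N)"
proof -
  have inv: "inverse_ops M (id_plus M L) (id_plus M V)"
    unfolding inverse_ops_def op_eq_def
    using bounded_op_id_plus[OF L_bounded] bounded_op_id_plus[OF V_bounded] by (auto simp: L_V V_L)
  have S: "op_eq M (id_plus M N) (id_plus M U \<circ> id_plus M L)"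
    unfolding op_eq_def by (auto simp: S_eq_U_L)
  have tri: "op_eq M (id_plus M j \<circ> cutoff \<zeta> \<mu>) (cutoff \<zeta> \<mu> \<circ> id_plus M j \<circ> cutoff \<zeta> \<mu>)"
    if j: "\<And>x t. x < t \<Longrightarrow> j x t = 0" for j \<mu>
    unfolding op_eq_def
  proof (intro ballI AE_I2)
    fix f x assume "f \<in> L2 M" and x: "x \<in> space M"
    show "(id_plus M j \<circ> cutoff \<zeta> \<mu>) f x = (cutoff \<zeta> \<mu> \<circ> id_plus M j \<circ> cutoff \<zeta> \<mu>) f x"
    proof (cases "\<mu> \<le> x")
      case True
      then show ?thesis using x by (simp add: cutoff_def space_M)
    next
      case False
      \<comment> \<open>Where the cutoff does not vanish, \<open>t\<close> is at least
        \<open>\<mu>\<close>, hence greater than \<open>x\<close>, and there \<open>j\<close> is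
        zero.\<close>
      then have "of_real (j x t) * cutoff \<zeta> \<mu> f t = 0" for t
        using j[of x t] by (auto simp: cutoff_def)
      then have "kernel_op M j (cutoff \<zeta> \<mu> f) x = 0"
        by (simp only: kernel_op_def Bochner_Integration.integral_zero)
      then show ?thesis using False by (simp add: id_plus_def cutoff_def)
    qed
  qed
  have "adjoint_ops M (id_plus M L) (id_plus M U)"
    using adjoint_ops_id_plus[OF L_bounded] .
  moreover have "op_eq M (id_plus M L \<circ> cutoff \<zeta> \<mu>) (cutoff \<zeta> \<mu> \<circ> id_plus M L \<circ> cutoff \<zeta> \<mu>)" for \<mu>
    by (rule tri) (simp add: U_def)
  moreover have "op_eq M (id_plus M V \<circ> cutoff \<zeta> \<mu>) (cutoff \<zeta> \<mu> \<circ> id_plus M V \<circ> cutoff \<zeta> \<mu>)" for \<mu>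
    by (rule tri) (simp add: V_def lower_def)
  ultimately show ?thesis
    unfolding factorable_def Let_def using inv S by blast
qed

lemma kernel_op_k_inner_self:
  assumes "f \<in> L2 M"
  shows "l2_inner M (kernel_op M k f) f = of_real (\<gamma> * ((l2_norm freq_measure (F f))\<^sup>2 / (2 * pi)))"
  unfolding kernel_op_k[abs_def] l2_inner_cmult_left sine_op_inner_self[OF assms] by simp

text \<open>Plancherel's inequality and \<open>\<gamma> \<le> 1\<close> suffice; the sharper
  constant \<open>sine_bound\<close> enters only through the Neumann series.\<close>

lemma positive_S: "positive_op M (id_plus M N)"
proof -
  have inner: "l2_inner M (id_plus M N f) f
      = of_real ((l2_norm M f)\<^sup>2 - \<gamma> * ((l2_norm freq_measure (F f))\<^sup>2 / (2 * pi)))"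
    if f: "f \<in> L2 M" for f
  proof -
    have "id_plus M N f = (\<lambda>x. f x - kernel_op M k f x)"
      unfolding id_plus_def N_def k_def kernel_op_scale by (intro ext) simp
    then have "l2_inner M (id_plus M N f) f = l2_inner M f f - l2_inner M (kernel_op M k f) f"
      by (simp add: l2_inner_diff_left f kernel_op_L2 k_bounded)
    then show ?thesis by (simp add: kernel_op_k_inner_self[OF f] l2_inner_self[of M f])
  qed
  have "\<gamma> * ((l2_norm freq_measure (F f))\<^sup>2 / (2 * pi)) \<le> (l2_norm M f)\<^sup>2" if f: "f \<in> L2 M" for f
  proof -
    have "(l2_norm freq_measure (F f))\<^sup>2 \<le> 2 * pi * (l2_norm M f)\<^sup>2"
      unfolding fourier_freq_norm[OF f] by (rule fourier_Plancherel_le[OF f])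
    then have "\<gamma> * ((l2_norm freq_measure (F f))\<^sup>2 / (2 * pi)) \<le> 1 * ((2 * pi * (l2_norm M f)\<^sup>2) / (2 * pi))"
      using \<gamma> by (intro mult_mono divide_right_mono) auto
    then show ?thesis by simp
  qed
  then have "l2_inner M (id_plus M N f) f \<in> \<real> \<and> 0 \<le> Re (l2_inner M (id_plus M N f) f)"
    if "f \<in> L2 M" for f
    unfolding inner[OF that] Re_complex_of_real using that by (intro conjI Reals_of_real) simp
  then show ?thesis
    unfolding positive_op_def using bounded_op_id_plus[OF N_bounded] by blast
qed

lemma positive_k: "positive_op M (kernel_op M k)"
  unfolding positive_op_def using bounded_op_kernel_op[OF k_bounded] \<gamma>
  by (auto simp: kernel_op_k_inner_self simp del: of_real_mult of_real_divide)

text \<open>The operator is positive and self-adjoint, so it is its own absolute value. Its diagonal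
  entries are energies on the band, and their partial sums are bounded by exchanging the finite sum
  with the integral over \<open>\<xi>\<close>.\<close>

lemma trace_class_k: "trace_class M (kernel_op M k)"
proof -
  have "(\<lambda>x t. k t x) = k" by (intro ext) (rule k_sym)
  then have "adjoint_ops M (kernel_op M k) (kernel_op M k)"
    unfolding adjoint_ops_def using bounded_op_kernel_op[OF k_bounded] kernel_op_adjoint[OF k_bounded] by simp
  then have abs: "absolute_value_op M (kernel_op M k) (kernel_op M k)"
    unfolding absolute_value_op_def op_eq_def using positive_k by auto
  obtain E where E: "orthonormal_basis M E" using orthonormal_basis_exists by blast
  then have EL2: "\<And>e. e \<in> E \<Longrightarrow> e \<in> L2 M"
    and orth: "\<And>e e'. e \<in> E \<Longrightarrow> e' \<in> E \<Longrightarrow> l2_inner M e e' = (if e = e' then 1 else 0)"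
    unfolding orthonormal_basis_def by auto
  define tr where "tr e = \<gamma> * ((l2_norm freq_measure (F e))\<^sup>2 / (2 * pi))" for e
  have tr_nonneg: "0 \<le> tr e" for e using \<gamma> by (simp add: tr_def)
  \<comment> \<open>At a fixed frequency the values \<open>F e \<xi>\<close> are conjugated
    coefficients of one exponential of modulus 1, whose squared norm is
    \<open>\<zeta> - a\<close>.\<close>
  have bessel: "(\<Sum>e\<in>D. (cmod (F e \<xi>))\<^sup>2) \<le> \<zeta> - a" if D: "finite D" "D \<subseteq> E" for D \<xi>
  proof -
    define c where "c t = exp (\<i> * of_real \<xi> * of_real t)" for t :: real
    have cL2: "c \<in> L2 M"
      by (rule L2_bounded(1)[of _ 1]) (auto simp: c_def[abs_def])
    have "F e \<xi> = cnj (l2_inner M c e)" for e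
      unfolding l2_inner_def fourier_def c_def Bochner_Integration.integral_cnj [symmetric]
      by (simp add: exp_cnj)
    then have "(\<Sum>e\<in>D. (cmod (F e \<xi>))\<^sup>2) = (\<Sum>e\<in>D. (cmod (l2_inner M c e))\<^sup>2)" by simp
    also have "\<dots> \<le> (l2_norm M c)\<^sup>2"
      by (intro L2_Bessel cL2 D) (use D in \<open>auto simp: subset_iff EL2 orth\<close>)
    also have "\<dots> = \<zeta> - a" by (simp add: l2_norm_sq c_def measure_M)
    finally show ?thesis .
  qed
  have "sum tr D \<le> \<gamma> * (2 * (\<zeta> - a) / (2 * pi))" if D: "finite D" "D \<subseteq> E" for D
  proof -
    have "(\<Sum>e\<in>D. (l2_norm freq_measure (F e))\<^sup>2)
        = (\<Sum>e\<in>D. integral {- 1..1} (\<lambda>\<xi>. (cmod (F e \<xi>))\<^sup>2))"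
      using D EL2 by (intro sum.cong) (auto simp: fourier_freq_norm)
    also have "\<dots> = integral {- 1..1} (\<lambda>\<xi>. \<Sum>e\<in>D. (cmod (F e \<xi>))\<^sup>2)"
      using D EL2
      by (intro Henstock_Kurzweil_Integration.integral_sum[symmetric] integrable_continuous_interval continuous_intros) auto
    also have "\<dots> \<le> integral {- 1..1::real} (\<lambda>\<xi>. \<zeta> - a)"
    proof (rule integral_le)
      show "(\<lambda>\<xi>. \<Sum>e\<in>D. (cmod (F e \<xi>))\<^sup>2) integrable_on {- 1..1}"
        by (intro integrable_continuous_interval continuous_intros) (use D EL2 in auto)
    qed (use bessel[OF D] in \<open>auto intro: integrable_continuous_interval\<close>)
    also have "integral {- 1..1} (\<lambda>\<xi>::real. \<zeta> - a) = 2 * (\<zeta> - a)" by simp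
    finally show ?thesis
      using \<gamma> unfolding tr_def sum_distrib_left[symmetric] sum_divide_distrib[symmetric]
      by (intro mult_left_mono divide_right_mono) auto
  qed
  then have "tr summable_on E"
    by (intro nonneg_bdd_above_summable_on) (auto simp: tr_nonneg intro!: bdd_aboveI2)
  then have "(\<lambda>e. complex_of_real (tr e)) summable_on E"
    by (rule summable_on_of_real)
  then have "(\<lambda>e. l2_inner M (kernel_op M k e) e) summable_on E"
    by (rule summable_on_cong[THEN iffD1, rotated]) (simp add: kernel_op_k_inner_self EL2 tr_def)
  then show ?thesis
    unfolding trace_class_def using abs E bounded_op_kernel_op[OF k_bounded] by blast
qed

end

theorem proposition6p12:
  fixes \<gamma> a \<zeta> :: real
  assumes "0 < \<gamma>" and "\<gamma> \<le> 1" and "a < \<zeta>"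
  shows "positive_op (interval_measure_on a \<zeta>) (S_op \<gamma> a \<zeta>)
       \<and> invertible_op (interval_measure_on a \<zeta>) (S_op \<gamma> a \<zeta>)
       \<and> factorable a \<zeta> (S_op \<gamma> a \<zeta>)
       \<and> trace_class (interval_measure_on a \<zeta>) (\<lambda>f x. f x - S_op \<gamma> a \<zeta> f x)"
proof -
  interpret sine_interval a \<zeta> \<gamma> by unfold_locales (use assms in auto)
  show ?thesis
    using positive_S invertible_S factorable_S trace_class_k
    unfolding minus_S_op_eq_kernel_op k_def[abs_def] N_def[abs_def]
    unfolding S_op_eq_id_plus by blast
qed

end
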